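(* Let $\mathcal{C}$ be an additive category with an exact structure $\mathcal{D}$. Let $DPEx(\mathcal{C})$ and $DIEx(\mathcal{C})$ be the classes of $\mathcal{D}$-projectively generated and of $\mathcal{D}$-injectively generated exact structures on $\mathcal{C}$, let $DCot(\mathcal{C})$ be the class of $\mathcal{D}$-cotorsion pairs in $\mathcal{C}$, and let $\Psi:DPEx(\mathcal{C})\to DCot(\mathcal{C})$, $\widetilde{\Psi}:DCot(\mathcal{C})\to DPEx(\mathcal{C})$, $\Phi:DIEx(\mathcal{C})\to DCot(\mathcal{C})$, $\widetilde{\Phi}:DCot(\mathcal{C})\to DIEx(\mathcal{C})$ be the maps $$\Psi(\mathcal{E})=\bigl({}^{\perp_{\mathcal{D}}}Div(\mathcal{D}\textrm{-}\mathcal{E}),\,Div(\mathcal{D}\textrm{-}\mathcal{E})\bigr),\qquad \widetilde{\Psi}(\mathcal{A},\mathcal{B})=\pi^{-1}_{\mathcal{D}}(\mathcal{A}),$$ $$\Phi(\mathcal{E})=\bigl(Flat(\mathcal{D}\textrm{-}\mathcal{E}),\,Flat(\mathcal{D}\textrm{-}\mathcal{E})^{\perp_{\mathcal{D}}}\bigr),\qquad \widetilde{\Phi}(\mathcal{A},\mathcal{B})=\iota^{-1}_{\mathcal{D}}(\mathcal{B}).$$ Then: (1) The pair $(\Psi,\widetilde{\Psi})$ is a monotone Galois connection between the posets $(DPEx(\mathcal{C}),\supseteq)$ and $(DCot(\mathcal{C}),\geq)$. (2) The pair $(\Phi,\widetilde{\Phi})$ is an antitone Galois connection between the posets $(DIEx(\mathcal{C}),\supseteq)$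 and $(DCot(\mathcal{C}),\geq)$.
   Context: An exact structure $\mathcal{E}$ on an additive category $\mathcal{C}$ (Quillen, with Keller's axioms) is a distinguished class of kernel-cokernel pairs $X\rightarrowtail Y\twoheadrightarrow Z$, called $\mathcal{E}$-conflations (their kernels are $\mathcal{E}$-inflations, their cokernels $\mathcal{E}$-deflations), such that: $1_0$ is a deflation; deflations are closed under composition; pullbacks of deflations along arbitrary morphisms exist and are deflations; pushouts of inflations along arbitrary morphisms exist and are inflations. $\mathrm{Ext}^1_{\mathcal{D}}(-,-)$ is the Yoneda bifunctor; $\mathrm{Ext}^1_{\mathcal{D}}(Z,X)=0$ iff every $\mathcal{D}$-conflation $X\rightarrowtail Y\twoheadrightarrow Z$ splits. For a class $\mathcal{A}$ of objects, $\mathcal{A}^{\perp_{\mathcal{D}}}=\{X\mid \mathrm{Ext}^1_{\mathcal{D}}(A,X)=0\ \forall A\in\mathcal{A}\}$ and ${}^{\perp_{\mathcal{D}}}\mathcal{A}=\{X\mid \mathrm{Ext}^1_{\mathcal{D}}(X,A)=0\ \forall A\in\mathcal{A}\}$. A $\mathcal{D}$-cotorsion pair is a pair $(\mathcal{A},\mathcal{B})$ of classes of objects with $\mathcal{A}^{\perp_{\mathcal{D}}}=\mathcal{B}$ and ${}^{\perp_{\mathcal{D}}}\mathcal{B}=\mathcal{A}$. For a class $\mathcal{M}$ of objects, $\pi^{-1}_{\mathcal{D}}(\mathcal{M})$ (the exact structure $\mathcal{D}$-projectively generated by $\mathcal{M}$) consists of the $\mathcal{D}$-conflations $X\to Y\to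 Z$ such that $0\to\mathrm{Hom}(M,X)\to\mathrm{Hom}(M,Y)\to\mathrm{Hom}(M,Z)\to 0$ is exact in abelian groups for every $M\in\mathcal{M}$; $\iota^{-1}_{\mathcal{D}}(\mathcal{M})$ (the exact structure $\mathcal{D}$-injectively generated by $\mathcal{M}$) consists of the $\mathcal{D}$-conflations $X\to Y\to Z$ such that $0\to\mathrm{Hom}(Z,M)\to\mathrm{Hom}(Y,M)\to\mathrm{Hom}(X,M)\to 0$ is exact for every $M\in\mathcal{M}$. An exact structure is $\mathcal{D}$-projectively (resp. $\mathcal{D}$-injectively) generated if it has the form $\pi^{-1}_{\mathcal{D}}(\mathcal{M})$ (resp. $\iota^{-1}_{\mathcal{D}}(\mathcal{M})$) for some class $\mathcal{M}$. An object $X$ is $\mathcal{D}$-$\mathcal{E}$-divisible if every $\mathcal{D}$-inflation $X\rightarrowtail Y$ is an $\mathcal{E}$-inflation, and $\mathcal{D}$-$\mathcal{E}$-flat if every $\mathcal{D}$-deflation $Y\twoheadrightarrow X$ is an $\mathcal{E}$-deflation; $Div(\mathcal{D}\textrm{-}\mathcal{E})$ and $Flat(\mathcal{D}\textrm{-}\mathcal{E})$ denote the corresponding classes. (The pairs $\Psi(\mathcal{E})$ and $\Phi(\mathcal{E})$ are indeed $\mathcal{D}$-cotorsion pairs.) Orders: $\mathcal{E}_1\supseteq\mathcal{E}_2$ iff every $\mathcal{E}_2$-conflation is an $\mathcal{E}_1$-conflation; $(\mathcal{A}_1,\mathcal{B}_1)\geq(\mathcal{A}_2,\mathcal{B}_2)$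 iff $\mathcal{A}_2\supseteq\mathcal{A}_1$ iff $\mathcal{B}_1\supseteq\mathcal{B}_2$. A monotone Galois connection between posets $(A,\leq)$ and $(B,\leq)$ is a pair $(\alpha,\beta)$ of order-preserving maps $\alpha:A\to B$, $\beta:B\to A$ such that for all $a\in A$, $b\in B$: $\alpha(a)\leq b$ iff $a\leq\beta(b)$; equivalently, $a\leq\beta\alpha(a)$ for all $a$ and $\alpha\beta(b)\leq b$ for all $b$. An antitone Galois connection between $(A,\leq)$ and $(B,\leq)$ is a monotone Galois connection between $(A,\leq)$ and $(B,\geq)$. When a poset is written $(P,R)$, the relation $R$ plays the role of $\leq$ in these definitions; thus, e.g., in (1) the condition reads: $\Psi(\mathcal{E})\geq(\mathcal{A},\mathcal{B})$ iff $\mathcal{E}\supseteq\widetilde{\Psi}(\mathcal{A},\mathcal{B})$, and in (2): $(\mathcal{A},\mathcal{B})\geq\Phi(\mathcal{E})$ iff $\mathcal{E}\supseteq\widetilde{\Phi}(\mathcal{A},\mathcal{B})$. *)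

theory Defs
  imports "HOL-Algebra.Exact_Sequence" "HOL-Algebra.Galois_Connection"
begin

section \<open>Additive categories\<close>

text \<open>
  Classes of objects are sets of elements of the type of objects, so sizes are relative to the
  (arbitrary) types of objects and arrows. Every arrow determines its domain and codomain.
\<close>

record ('o, 'm) precat =
  Ob :: "'o set"
  Arr :: "'m set"
  Dom :: "'m \<Rightarrow> 'o"
  Cod :: "'m \<Rightarrow> 'o"
  Ide :: "'o \<Rightarrow> 'm"
  Cmp :: "'m \<Rightarrow> 'm \<Rightarrow> 'm" (infixl \<open>\<cdot>\<index>\<close> 70)
  Add :: "'m \<Rightarrow> 'm \<Rightarrow> 'm" (infixl \<open>\<boxplus>\<index>\<close> 65)
  Nul :: "'o \<Rightarrow> 'o \<Rightarrow> 'm"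

definition Hom :: "('o, 'm, 'z) precat_scheme \<Rightarrow> 'o \<Rightarrow> 'o \<Rightarrow> 'm set" where
  "Hom C X Y = {f \<in> Arr C. Dom C f = X \<and> Cod C f = Y}"

text \<open>The group structure on a hom-set, in the multiplicative notation of HOL-Algebra.\<close>

definition Hom_group :: "('o, 'm, 'z) precat_scheme \<Rightarrow> 'o \<Rightarrow> 'o \<Rightarrow> 'm monoid" where
  "Hom_group C X Y = \<lparr>carrier = Hom C X Y, mult = Add C, one = Nul C X Y\<rparr>"

locale category =
  fixes C (structure)
  assumes Dom_closed: "f \<in> Arr C \<Longrightarrow> Dom C f \<in> Ob C"
    and Cod_closed: "f \<in> Arr C \<Longrightarrow> Cod C f \<in> Ob C"
    and Ide_closed: "X \<in> Ob C \<Longrightarrow> Ide C X \<in> Hom C X X"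
    and Cmp_closed: "\<lbrakk>f \<in> Hom C X Y; g \<in> Hom C Y Z\<rbrakk> \<Longrightarrow> g \<cdot> f \<in> Hom C X Z"
    and Cmp_assoc: "\<lbrakk>f \<in> Hom C W X; g \<in> Hom C X Y; h \<in> Hom C Y Z\<rbrakk> \<Longrightarrow> h \<cdot> g \<cdot> f = h \<cdot> (g \<cdot> f)"
    and Ide_left: "f \<in> Hom C X Y \<Longrightarrow> Ide C Y \<cdot> f = f"
    and Ide_right: "f \<in> Hom C X Y \<Longrightarrow> f \<cdot> Ide C X = f"

locale preadditive_category = category C for C (structure) +
  assumes Hom_comm_group: "\<lbrakk>X \<in> Ob C; Y \<in> Ob C\<rbrakk> \<Longrightarrow> comm_group (Hom_group C X Y)"
    and Cmp_Add_right: "\<lbrakk>f \<in> Hom C X Y; f' \<in> Hom C X Y; g \<in> Hom C Y Z\<rbrakk>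
      \<Longrightarrow> g \<cdot> (f \<boxplus> f') = g \<cdot> f \<boxplus> g \<cdot> f'"
    and Cmp_Add_left: "\<lbrakk>f \<in> Hom C X Y; g \<in> Hom C Y Z; g' \<in> Hom C Y Z\<rbrakk>
      \<Longrightarrow> (g \<boxplus> g') \<cdot> f = g \<cdot> f \<boxplus> g' \<cdot> f"

definition zero_object :: "('o, 'm, 'z) precat_scheme \<Rightarrow> 'o \<Rightarrow> bool" where
  "zero_object C N \<longleftrightarrow> N \<in> Ob C \<and>
     (\<forall>X\<in>Ob C. (\<exists>!f. f \<in> Hom C X N) \<and> (\<exists>!f. f \<in> Hom C N X))"

text \<open>\<^term>\<open>P\<close> is the biproduct of \<^term>\<open>X\<close> and \<^term>\<open>Y\<close> with injections
  \<^term>\<open>i\<close>, \<^term>\<open>j\<close> and projections \<^term>\<open>p\<close>, \<^term>\<open>q\<close>.\<close>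

definition biproduct ::
  "('o, 'm, 'z) precat_scheme \<Rightarrow> 'o \<Rightarrow> 'o \<Rightarrow> 'o \<Rightarrow> 'm \<Rightarrow> 'm \<Rightarrow> 'm \<Rightarrow> 'm \<Rightarrow> bool" where
  "biproduct C X Y P i j p q \<longleftrightarrow>
     i \<in> Hom C X P \<and> j \<in> Hom C Y P \<and> p \<in> Hom C P X \<and> q \<in> Hom C P Y \<and>
     p \<cdot>\<^bsub>C\<^esub> i = Ide C X \<and> q \<cdot>\<^bsub>C\<^esub> j = Ide C Y \<and>
     p \<cdot>\<^bsub>C\<^esub> j = Nul C Y X \<and> q \<cdot>\<^bsub>C\<^esub> i = Nul C X Y \<and>
     i \<cdot>\<^bsub>C\<^esub> p \<boxplus>\<^bsub>C\<^esub> j \<cdot>\<^bsub>C\<^esub> q = Ide C P"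

locale additive_category = preadditive_category C for C (structure) +
  assumes has_zero_object: "\<exists>N. zero_object C N"
    and has_biproducts: "\<lbrakk>X \<in> Ob C; Y \<in> Ob C\<rbrakk> \<Longrightarrow> \<exists>P i j p q. biproduct C X Y P i j p q"


section \<open>Kernel-cokernel pairs and exact structures\<close>

definition isomorphism :: "('o, 'm, 'z) precat_scheme \<Rightarrow> 'o \<Rightarrow> 'o \<Rightarrow> 'm \<Rightarrow> bool" where
  "isomorphism C X Y f \<longleftrightarrow> f \<in> Hom C X Y \<and>
     (\<exists>g\<in>Hom C Y X. g \<cdot>\<^bsub>C\<^esub> f = Ide C X \<and> f \<cdot>\<^bsub>C\<^esub> g = Ide C Y)"

definition is_kernel :: "('o, 'm, 'z) precat_scheme \<Rightarrow> 'm \<Rightarrow> 'm \<Rightarrow> bool" where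
  "is_kernel C f g \<longleftrightarrow> f \<in> Arr C \<and> g \<in> Arr C \<and> Cod C f = Dom C g \<and>
     g \<cdot>\<^bsub>C\<^esub> f = Nul C (Dom C f) (Cod C g) \<and>
     (\<forall>W\<in>Ob C. \<forall>h\<in>Hom C W (Dom C g). g \<cdot>\<^bsub>C\<^esub> h = Nul C W (Cod C g) \<longrightarrow>
        (\<exists>!k. k \<in> Hom C W (Dom C f) \<and> f \<cdot>\<^bsub>C\<^esub> k = h))"

definition is_cokernel :: "('o, 'm, 'z) precat_scheme \<Rightarrow> 'm \<Rightarrow> 'm \<Rightarrow> bool" where
  "is_cokernel C g f \<longleftrightarrow> f \<in> Arr C \<and> g \<in> Arr C \<and> Cod C f = Dom C g \<and>
     g \<cdot>\<^bsub>C\<^esub> f = Nul C (Dom C f) (Cod C g) \<and>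
     (\<forall>W\<in>Ob C. \<forall>h\<in>Hom C (Cod C f) W. h \<cdot>\<^bsub>C\<^esub> f = Nul C (Dom C f) W \<longrightarrow>
        (\<exists>!k. k \<in> Hom C (Cod C g) W \<and> k \<cdot>\<^bsub>C\<^esub> g = h))"

text \<open>\<^term>\<open>d'\<close> is the pullback of \<^term>\<open>d\<close> along \<^term>\<open>h\<close>, where
  \<^term>\<open>d\<close> and \<^term>\<open>h\<close> have a common codomain.\<close>

definition is_pullback ::
  "('o, 'm, 'z) precat_scheme \<Rightarrow> 'm \<Rightarrow> 'm \<Rightarrow> 'm \<Rightarrow> 'm \<Rightarrow> bool" where
  "is_pullback C d h d' h' \<longleftrightarrow>
     d \<in> Arr C \<and> h \<in> Arr C \<and> d' \<in> Arr C \<and> h' \<in> Arr C \<and>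
     Cod C d = Cod C h \<and> Dom C d' = Dom C h' \<and> Cod C d' = Dom C h \<and> Cod C h' = Dom C d \<and>
     d \<cdot>\<^bsub>C\<^esub> h' = h \<cdot>\<^bsub>C\<^esub> d' \<and>
     (\<forall>W\<in>Ob C. \<forall>u\<in>Hom C W (Dom C d). \<forall>v\<in>Hom C W (Dom C h). d \<cdot>\<^bsub>C\<^esub> u = h \<cdot>\<^bsub>C\<^esub> v \<longrightarrow>
        (\<exists>!t. t \<in> Hom C W (Dom C d') \<and> h' \<cdot>\<^bsub>C\<^esub> t = u \<and> d' \<cdot>\<^bsub>C\<^esub> t = v))"

text \<open>Dually, \<^term>\<open>i'\<close> is the pushout of \<^term>\<open>i\<close> along \<^term>\<open>h\<close>.\<close>

definition is_pushout ::
  "('o, 'm, 'z) precat_scheme \<Rightarrow> 'm \<Rightarrow> 'm \<Rightarrow> 'm \<Rightarrow> 'm \<Rightarrow> bool" where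
  "is_pushout C i h i' h' \<longleftrightarrow>
     i \<in> Arr C \<and> h \<in> Arr C \<and> i' \<in> Arr C \<and> h' \<in> Arr C \<and>
     Dom C i = Dom C h \<and> Cod C i' = Cod C h' \<and> Dom C i' = Cod C h \<and> Dom C h' = Cod C i \<and>
     h' \<cdot>\<^bsub>C\<^esub> i = i' \<cdot>\<^bsub>C\<^esub> h \<and>
     (\<forall>W\<in>Ob C. \<forall>u\<in>Hom C (Cod C i) W. \<forall>v\<in>Hom C (Cod C h) W. u \<cdot>\<^bsub>C\<^esub> i = v \<cdot>\<^bsub>C\<^esub> h \<longrightarrow>
        (\<exists>!t. t \<in> Hom C (Cod C i') W \<and> t \<cdot>\<^bsub>C\<^esub> h' = u \<and> t \<cdot>\<^bsub>C\<^esub> i' = v))"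

text \<open>A class of composable pairs is a set of pairs of arrows \<^term>\<open>(f, g)\<close>, standing for
  \<open>X \<rightarrow> Y \<rightarrow> Z\<close> with first arrow \<^term>\<open>f\<close> and second arrow \<^term>\<open>g\<close>.\<close>

definition inflation :: "('m \<times> 'm) set \<Rightarrow> 'm \<Rightarrow> bool" where
  "inflation E f \<longleftrightarrow> (\<exists>g. (f, g) \<in> E)"

definition deflation :: "('m \<times> 'm) set \<Rightarrow> 'm \<Rightarrow> bool" where
  "deflation E g \<longleftrightarrow> (\<exists>f. (f, g) \<in> E)"

text \<open>As usual for exact categories (Quillen, Keller), the class of conflations is closed under
  isomorphisms of pairs.\<close>

locale exact_structure = additive_category C for C (structure) +
  fixes E :: "('b \<times> 'b) set"
  assumes kernel_cokernel: "(f, g) \<in> E \<Longrightarrow> is_kernel C f g \<and> is_cokernel C g f"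
    and iso_closed:
      "\<lbrakk>(f, g) \<in> E; isomorphism C (Dom C f) X a; isomorphism C (Cod C f) Y b; isomorphism C (Cod C g) Z c;
        f' \<in> Hom C X Y; g' \<in> Hom C Y Z; f' \<cdot> a = b \<cdot> f; g' \<cdot> b = c \<cdot> g\<rbrakk> \<Longrightarrow> (f', g') \<in> E"
    and Ide_zero_deflation: "zero_object C N \<Longrightarrow> deflation E (Ide C N)"
    and deflation_comp:
      "\<lbrakk>deflation E d; deflation E e; Cod C d = Dom C e\<rbrakk> \<Longrightarrow> deflation E (e \<cdot> d)"
    and deflation_pullback_ex:
      "\<lbrakk>deflation E d; h \<in> Arr C; Cod C h = Cod C d\<rbrakk> \<Longrightarrow> \<exists>d' h'. is_pullback C d h d' h'"
    and deflation_pullback: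
      "\<lbrakk>deflation E d; is_pullback C d h d' h'\<rbrakk> \<Longrightarrow> deflation E d'"
    and inflation_pushout_ex:
      "\<lbrakk>inflation E i; h \<in> Arr C; Dom C h = Dom C i\<rbrakk> \<Longrightarrow> \<exists>i' h'. is_pushout C i h i' h'"
    and inflation_pushout:
      "\<lbrakk>inflation E i; is_pushout C i h i' h'\<rbrakk> \<Longrightarrow> inflation E i'"


section \<open>Yoneda extensions and cotorsion pairs\<close>

definition extensions ::
  "('o, 'm, 'z) precat_scheme \<Rightarrow> ('m \<times> 'm) set \<Rightarrow> 'o \<Rightarrow> 'o \<Rightarrow> ('m \<times> 'm) set" where
  "extensions C D Z X = {(f, g) \<in> D. Dom C f = X \<and> Cod C g = Z}"

definition yoneda_equiv ::
  "('o, 'm, 'z) precat_scheme \<Rightarrow> ('m \<times> 'm) set \<Rightarrow> 'o \<Rightarrow> 'o \<Rightarrow> (('m \<times> 'm) \<times> ('m \<times> 'm)) set" where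
  "yoneda_equiv C D Z X =
     {((f, g), (f', g')). (f, g) \<in> extensions C D Z X \<and> (f', g') \<in> extensions C D Z X \<and>
        (\<exists>h. isomorphism C (Cod C f) (Cod C f') h \<and> h \<cdot>\<^bsub>C\<^esub> f = f' \<and> g' \<cdot>\<^bsub>C\<^esub> h = g)}"

definition Ext1 ::
  "('o, 'm, 'z) precat_scheme \<Rightarrow> ('m \<times> 'm) set \<Rightarrow> 'o \<Rightarrow> 'o \<Rightarrow> ('m \<times> 'm) set set" where
  "Ext1 C D Z X = extensions C D Z X // yoneda_equiv C D Z X"

text \<open>A pair splits if it is of the form \<open>X \<rightarrow> X \<oplus> Z \<rightarrow> Z\<close>, with the
  canonical injection and projection.\<close>

definition split_pair :: "('o, 'm, 'z) precat_scheme \<Rightarrow> 'm \<Rightarrow> 'm \<Rightarrow> bool" where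
  "split_pair C f g \<longleftrightarrow> (\<exists>s r. biproduct C (Dom C f) (Cod C g) (Cod C f) f s r g)"

text \<open>The zero element of the abelian group of Yoneda extensions, i.e. the class of all split
  conflations. The addition (Baer sum) is not needed to state that the group is zero.\<close>

definition Ext1_zero ::
  "('o, 'm, 'z) precat_scheme \<Rightarrow> ('m \<times> 'm) set \<Rightarrow> 'o \<Rightarrow> 'o \<Rightarrow> ('m \<times> 'm) set" where
  "Ext1_zero C D Z X = {(f, g) \<in> extensions C D Z X. split_pair C f g}"

definition right_perp ::
  "('o, 'm, 'z) precat_scheme \<Rightarrow> ('m \<times> 'm) set \<Rightarrow> 'o set \<Rightarrow> 'o set" where
  "right_perp C D \<A> = {X \<in> Ob C. \<forall>A\<in>\<A>. Ext1 C D A X = {Ext1_zero C D A X}}"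

definition left_perp ::
  "('o, 'm, 'z) precat_scheme \<Rightarrow> ('m \<times> 'm) set \<Rightarrow> 'o set \<Rightarrow> 'o set" where
  "left_perp C D \<A> = {X \<in> Ob C. \<forall>A\<in>\<A>. Ext1 C D X A = {Ext1_zero C D X A}}"

definition cotorsion_pairs ::
  "('o, 'm, 'z) precat_scheme \<Rightarrow> ('m \<times> 'm) set \<Rightarrow> ('o set \<times> 'o set) set" where
  "cotorsion_pairs C D = {(\<A>, \<B>). \<A> \<subseteq> Ob C \<and> \<B> \<subseteq> Ob C \<and>
     right_perp C D \<A> = \<B> \<and> left_perp C D \<B> = \<A>}"


section \<open>Projectively and injectively generated exact structures\<close>

text \<open>\<open>0 \<rightarrow> K \<rightarrow> L \<rightarrow> M \<rightarrow> 0\<close> is exact; \<^const>\<open>exact_seq\<close> lists groups and maps from right to left.\<close>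

definition short_exact :: "'a monoid \<Rightarrow> 'a monoid \<Rightarrow> 'a monoid \<Rightarrow> ('a \<Rightarrow> 'a) \<Rightarrow> ('a \<Rightarrow> 'a) \<Rightarrow> bool" where
  "short_exact K L M u v \<longleftrightarrow>
     exact_seq ([singleton_group \<one>\<^bsub>M\<^esub>, M, L, K, singleton_group \<one>\<^bsub>K\<^esub>],
                [\<lambda>_. \<one>\<^bsub>M\<^esub>, v, u, \<lambda>_. \<one>\<^bsub>K\<^esub>])"

definition proj_generated ::
  "('o, 'm, 'z) precat_scheme \<Rightarrow> ('m \<times> 'm) set \<Rightarrow> 'o set \<Rightarrow> ('m \<times> 'm) set" where
  "proj_generated C D \<M> = {(f, g) \<in> D. \<forall>M\<in>\<M>.
     short_exact (Hom_group C M (Dom C f)) (Hom_group C M (Cod C f)) (Hom_group C M (Cod C g))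
       (\<lambda>h. f \<cdot>\<^bsub>C\<^esub> h) (\<lambda>h. g \<cdot>\<^bsub>C\<^esub> h)}"

definition inj_generated ::
  "('o, 'm, 'z) precat_scheme \<Rightarrow> ('m \<times> 'm) set \<Rightarrow> 'o set \<Rightarrow> ('m \<times> 'm) set" where
  "inj_generated C D \<M> = {(f, g) \<in> D. \<forall>M\<in>\<M>.
     short_exact (Hom_group C (Cod C g) M) (Hom_group C (Cod C f) M) (Hom_group C (Dom C f) M)
       (\<lambda>h. h \<cdot>\<^bsub>C\<^esub> g) (\<lambda>h. h \<cdot>\<^bsub>C\<^esub> f)}"

definition DPEx :: "('o, 'm, 'z) precat_scheme \<Rightarrow> ('m \<times> 'm) set \<Rightarrow> ('m \<times> 'm) set set" where
  "DPEx C D = {E. exact_structure C E \<and> (\<exists>\<M>\<subseteq>Ob C. E = proj_generated C D \<M>)}"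

definition DIEx :: "('o, 'm, 'z) precat_scheme \<Rightarrow> ('m \<times> 'm) set \<Rightarrow> ('m \<times> 'm) set set" where
  "DIEx C D = {E. exact_structure C E \<and> (\<exists>\<M>\<subseteq>Ob C. E = inj_generated C D \<M>)}"

definition divisible ::
  "('o, 'm, 'z) precat_scheme \<Rightarrow> ('m \<times> 'm) set \<Rightarrow> ('m \<times> 'm) set \<Rightarrow> 'o set" where
  "divisible C D E = {X \<in> Ob C. \<forall>f. inflation D f \<and> Dom C f = X \<longrightarrow> inflation E f}"

definition flat ::
  "('o, 'm, 'z) precat_scheme \<Rightarrow> ('m \<times> 'm) set \<Rightarrow> ('m \<times> 'm) set \<Rightarrow> 'o set" where
  "flat C D E = {X \<in> Ob C. \<forall>g. deflation D g \<and> Cod C g = X \<longrightarrow> deflation E g}"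


section \<open>The maps and the orders\<close>

definition Psi ::
  "('o, 'm, 'z) precat_scheme \<Rightarrow> ('m \<times> 'm) set \<Rightarrow> ('m \<times> 'm) set \<Rightarrow> 'o set \<times> 'o set" where
  "Psi C D E = (left_perp C D (divisible C D E), divisible C D E)"

definition Psi_tilde ::
  "('o, 'm, 'z) precat_scheme \<Rightarrow> ('m \<times> 'm) set \<Rightarrow> 'o set \<times> 'o set \<Rightarrow> ('m \<times> 'm) set" where
  "Psi_tilde C D = (\<lambda>(\<A>, \<B>). proj_generated C D \<A>)"

definition Phi ::
  "('o, 'm, 'z) precat_scheme \<Rightarrow> ('m \<times> 'm) set \<Rightarrow> ('m \<times> 'm) set \<Rightarrow> 'o set \<times> 'o set" where
  "Phi C D E = (flat C D E, right_perp C D (flat C D E))"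

definition Phi_tilde ::
  "('o, 'm, 'z) precat_scheme \<Rightarrow> ('m \<times> 'm) set \<Rightarrow> 'o set \<times> 'o set \<Rightarrow> ('m \<times> 'm) set" where
  "Phi_tilde C D = (\<lambda>(\<A>, \<B>). inj_generated C D \<B>)"

text \<open>In the ordered structures below the field \<^const>\<open>le\<close> is the displayed relation itself:
  it is the reverse inclusion of exact structures, and \<open>\<ge>\<close> of cotorsion pairs.\<close>

definition exact_order :: "('m \<times> 'm) set set \<Rightarrow> ('m \<times> 'm) set gorder" where
  "exact_order \<E> = \<lparr>carrier = \<E>, eq = (=), le = (\<lambda>E\<^sub>1 E\<^sub>2. E\<^sub>1 \<supseteq> E\<^sub>2)\<rparr>"

definition cot_ge :: "'o set \<times> 'o set \<Rightarrow> 'o set \<times> 'o set \<Rightarrow> bool" where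
  "cot_ge = (\<lambda>(\<A>\<^sub>1, \<B>\<^sub>1) (\<A>\<^sub>2, \<B>\<^sub>2). \<A>\<^sub>2 \<supseteq> \<A>\<^sub>1)"

definition cot_order :: "('o set \<times> 'o set) set \<Rightarrow> ('o set \<times> 'o set) gorder" where
  "cot_order \<P> = \<lparr>carrier = \<P>, eq = (=), le = cot_ge\<rparr>"

lemma cot_ge_iff:
  assumes "(\<A>\<^sub>1, \<B>\<^sub>1) \<in> cotorsion_pairs C D" and "(\<A>\<^sub>2, \<B>\<^sub>2) \<in> cotorsion_pairs C D"
  shows "cot_ge (\<A>\<^sub>1, \<B>\<^sub>1) (\<A>\<^sub>2, \<B>\<^sub>2) \<longleftrightarrow> \<B>\<^sub>1 \<supseteq> \<B>\<^sub>2"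
proof -
  have anti: "right_perp C D \<A>\<^sub>2 \<subseteq> right_perp C D \<A>\<^sub>1" if "\<A>\<^sub>1 \<subseteq> \<A>\<^sub>2"
    using that unfolding right_perp_def by blast
  have "left_perp C D \<B>\<^sub>1 \<subseteq> left_perp C D \<B>\<^sub>2" if "\<B>\<^sub>2 \<subseteq> \<B>\<^sub>1"
    using that unfolding left_perp_def by blast
  with anti assms show ?thesis
    by (simp add: cotorsion_pairs_def cot_ge_def) blast
qed

definition monotone_galois_connection ::
  "'a gorder \<Rightarrow> 'b gorder \<Rightarrow> ('a \<Rightarrow> 'b) \<Rightarrow> ('b \<Rightarrow> 'a) \<Rightarrow> bool" where
  "monotone_galois_connection A B \<alpha> \<beta> \<longleftrightarrow> isotone A B \<alpha> \<and> isotone B A \<beta> \<and>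
     galois_connection \<lparr>orderA = A, orderB = B, lower = \<alpha>, upper = \<beta>\<rparr>"

definition antitone_galois_connection ::
  "'a gorder \<Rightarrow> 'b gorder \<Rightarrow> ('a \<Rightarrow> 'b) \<Rightarrow> ('b \<Rightarrow> 'a) \<Rightarrow> bool" where
  "antitone_galois_connection A B \<alpha> \<beta> \<longleftrightarrow> monotone_galois_connection A (inv_gorder B) \<alpha> \<beta>"

end

theory Submission
  imports Defs
begin

text \<open>
  If \<open>\<E>\<close> is \<open>\<D>\<close>-projectively generated by \<open>\<M>\<close>, then the divisible objects are exactly the right
  orthogonal of \<open>\<M>\<close>: a morphism \<open>M \<rightarrow> Z\<close> lifts through a conflation \<open>X \<rightarrow> Y \<rightarrow> Z\<close> iff the pullback
  \<open>X \<rightarrow> P \<rightarrow> M\<close> splits. Hence \<open>\<Psi>(\<E>)\<close> is the cotorsion pair generated by \<open>\<M>\<close>, and the adjunction is the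
  formal Galois correspondence of orthogonals. That the generated classes are exact structures at all
  is elementary, except that for injectively generated ones the composition of deflations needs a
  two-step extension of morphisms. The flat case is the divisible case in the opposite category.
\<close>

section \<open>Opposite categories\<close>

text \<open>\<open>DPEx\<close> and \<open>DIEx\<close> contain only classes that satisfy all the
  axioms of an exact structure, so every value of \<open>Psi_tilde\<close> and
  \<open>Phi_tilde\<close> has to be proved exact; this takes more work than the adjunctions. Two
  reductions make the rest elementary. \<open>Ext1\<close> is a bare quotient set without Baer sum,
  and its vanishing is always used in the form "every such conflation splits". Exactness of a Hom
  sequence is used as a lifting property, dually an extension property, because the kernel condition
  already gives left exactness. Dualization reverses the arrows and also the pairs: a class
  \<open>E\<close> in \<open>C\<close> becomes \<open>E\<inverse>\<close> in
  \<open>opposite C\<close>.\<close>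

definition opposite :: "('o, 'm, 'z) precat_scheme \<Rightarrow> ('o, 'm, 'z) precat_scheme" where
  "opposite C = C\<lparr>Dom := Cod C, Cod := Dom C, Cmp := (\<lambda>g f. Cmp C f g), Nul := (\<lambda>X Y. Nul C Y X)\<rparr>"

lemma opposite_simps [simp]:
  "Ob (opposite C) = Ob C" "Arr (opposite C) = Arr C"
  "Dom (opposite C) = Cod C" "Cod (opposite C) = Dom C"
  "Ide (opposite C) = Ide C" "Cmp (opposite C) = (\<lambda>g f. Cmp C f g)"
  "Add (opposite C) = Add C" "Nul (opposite C) X Y = Nul C Y X"
  by (simp_all add: opposite_def)

text \<open>This is an equality of records, not an isomorphism of categories, so a dual lemma can be
  obtained by instantiating at the opposite and letting the simplifier erase a double
  opposite.\<close>

lemma opposite_opposite [simp]: "opposite (opposite C) = C"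
  by (cases C) (simp add: opposite_def)

lemma Hom_opposite [simp]: "Hom (opposite C) X Y = Hom C Y X"
  by (auto simp: Hom_def)

lemma Hom_group_opposite [simp]: "Hom_group (opposite C) X Y = Hom_group C Y X"
  by (simp add: Hom_group_def)

lemma is_kernel_opposite [simp]: "is_kernel (opposite C) f g \<longleftrightarrow> is_cokernel C f g"
  unfolding is_kernel_def is_cokernel_def by auto

lemma is_cokernel_opposite [simp]: "is_cokernel (opposite C) g f \<longleftrightarrow> is_kernel C g f"
  unfolding is_kernel_def is_cokernel_def by auto

lemma is_pullback_opposite [simp]: "is_pullback (opposite C) d h d' h' \<longleftrightarrow> is_pushout C d h d' h'"
  unfolding is_pullback_def is_pushout_def by auto

lemma is_pushout_opposite [simp]: "is_pushout (opposite C) i h i' h' \<longleftrightarrow> is_pullback C i h i' h'"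
  unfolding is_pullback_def is_pushout_def by auto

lemma biproduct_opposite [simp]:
  "biproduct (opposite C) X Y P i j p q \<longleftrightarrow> biproduct C X Y P p q i j"
  unfolding biproduct_def by auto

lemma zero_object_opposite [simp]: "zero_object (opposite C) N \<longleftrightarrow> zero_object C N"
  unfolding zero_object_def by auto

lemma inflation_converse [simp]: "inflation (E\<inverse>) f \<longleftrightarrow> deflation E f"
  by (simp add: inflation_def deflation_def)

lemma deflation_converse [simp]: "deflation (E\<inverse>) g \<longleftrightarrow> inflation E g"
  by (simp add: inflation_def deflation_def)

lemma divisible_opposite [simp]: "divisible (opposite C) (D\<inverse>) (E\<inverse>) = flat C D E"
  by (simp add: divisible_def flat_def)


section \<open>Additive categories\<close>

context category
begin

lemma Hom_Ob: "f \<in> Hom C X Y \<Longrightarrow> X \<in> Ob C" "f \<in> Hom C X Y \<Longrightarrow> Y \<in> Ob C"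
  using Dom_closed Cod_closed by (auto simp: Hom_def)

lemma Hom_D: "f \<in> Hom C X Y \<Longrightarrow> f \<in> Arr C \<and> Dom C f = X \<and> Cod C f = Y"
  by (simp add: Hom_def)

lemma category_opposite: "category (opposite C)"
  by unfold_locales
    (auto simp: Dom_closed Cod_closed Ide_closed Cmp_closed Cmp_assoc Ide_left Ide_right)

end

context preadditive_category
begin

lemma preadditive_category_opposite: "preadditive_category (opposite C)"
  by (intro preadditive_category.intro category_opposite preadditive_category_axioms.intro)
    (auto simp: Hom_comm_group Cmp_Add_left Cmp_Add_right)

section \<open>Arithmetic in the hom-groups\<close>

lemma Nul_closed: "X \<in> Ob C \<Longrightarrow> Y \<in> Ob C \<Longrightarrow> Nul C X Y \<in> Hom C X Y"
  using monoid.one_closed[OF comm_group.axioms(1)[THEN comm_monoid.axioms(1)], of "Hom_group C X Y"]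
    Hom_comm_group[of X Y] by (simp add: Hom_group_def)

lemma Add_closed:
  assumes "f \<in> Hom C X Y" "g \<in> Hom C X Y" shows "f \<boxplus> g \<in> Hom C X Y"
proof -
  interpret comm_group "Hom_group C X Y" using Hom_comm_group Hom_Ob assms by metis
  show ?thesis using m_closed assms by (simp add: Hom_group_def)
qed

lemma Add_commute:
  assumes "f \<in> Hom C X Y" "g \<in> Hom C X Y" shows "f \<boxplus> g = g \<boxplus> f"
proof -
  interpret comm_group "Hom_group C X Y" using Hom_comm_group Hom_Ob assms by metis
  show ?thesis using m_comm assms by (simp add: Hom_group_def)
qed

lemma Add_Nul:
  assumes "f \<in> Hom C X Y" shows "f \<boxplus> Nul C X Y = f" "Nul C X Y \<boxplus> f = f"
proof -
  interpret comm_group "Hom_group C X Y" using Hom_comm_group Hom_Ob assms by metis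
  show "f \<boxplus> Nul C X Y = f" "Nul C X Y \<boxplus> f = f"
    using r_one l_one assms by (simp_all add: Hom_group_def)
qed

lemma Add_cancel:
  assumes "f \<in> Hom C X Y" "g \<in> Hom C X Y" "f \<boxplus> g = g" shows "f = Nul C X Y"
proof -
  interpret comm_group "Hom_group C X Y" using Hom_comm_group Hom_Ob assms by metis
  show ?thesis using l_cancel_one[of g f] m_comm[of f g] assms by (simp add: Hom_group_def)
qed

text \<open>The record has addition but no subtraction. The existential form supplies differences
  such as \<open>Ide C Y\<close> minus \<open>s \<cdot> g\<close> without introducing inverses into
  the categorical notation.\<close>

lemma difference_ex:
  assumes "f \<in> Hom C X Y" "g \<in> Hom C X Y" shows "\<exists>w\<in>Hom C X Y. f = w \<boxplus> g"
proof -
  interpret comm_group "Hom_group C X Y" using Hom_comm_group Hom_Ob assms by metis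
  let ?G = "Hom_group C X Y"
  have fg: "f \<in> carrier ?G" "g \<in> carrier ?G" using assms by (simp_all add: Hom_group_def)
  then have "f = f \<otimes>\<^bsub>?G\<^esub> inv\<^bsub>?G\<^esub> g \<otimes>\<^bsub>?G\<^esub> g"
    by (simp only: m_assoc inv_closed l_inv r_one)
  moreover have "f \<otimes>\<^bsub>?G\<^esub> inv\<^bsub>?G\<^esub> g \<in> carrier ?G" using fg by simp
  ultimately show ?thesis
    by (metis Hom_group_def monoid.select_convs(1) partial_object.select_convs(1))
qed

text \<open>By additivity \<open>g \<cdot> 0\<close> is its own double, and in a group only the
  neutral element has this property.\<close>

lemma Cmp_Nul_right:
  assumes "g \<in> Hom C Y Z" "X \<in> Ob C" shows "g \<cdot> Nul C X Y = Nul C X Z"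
proof (rule Add_cancel)
  have n: "Nul C X Y \<in> Hom C X Y" using Nul_closed assms Hom_Ob by metis
  show c: "g \<cdot> Nul C X Y \<in> Hom C X Z" "g \<cdot> Nul C X Y \<in> Hom C X Z"
    using Cmp_closed n assms by blast+
  show "g \<cdot> Nul C X Y \<boxplus> g \<cdot> Nul C X Y = g \<cdot> Nul C X Y"
    using Cmp_Add_right[OF n n assms(1)] Add_Nul[OF n] by simp
qed

lemma Cmp_Nul_left:
  assumes "f \<in> Hom C X Y" "Z \<in> Ob C" shows "Nul C Y Z \<cdot> f = Nul C X Z"
  using preadditive_category.Cmp_Nul_right[OF preadditive_category_opposite] assms by fastforce

section \<open>Universal properties of kernels, cokernels and pushouts\<close>

lemma kernel_factor:
  assumes "is_kernel C f g" "f \<in> Hom C X Y" "g \<in> Hom C Y Z" "h \<in> Hom C W Y" "g \<cdot> h = Nul C W Z"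
  obtains k where "k \<in> Hom C W X" "f \<cdot> k = h"
proof -
  have "W \<in> Ob C" using assms Hom_Ob by blast
  then have "\<exists>!k. k \<in> Hom C W X \<and> f \<cdot> k = h"
    using assms(1) assms(2-4)[THEN Hom_D] assms(4,5) unfolding is_kernel_def by auto
  then show ?thesis using that by blast
qed

lemma kernel_mono:
  assumes "is_kernel C f g" "f \<in> Hom C X Y" "k \<in> Hom C W X" "k' \<in> Hom C W X" "f \<cdot> k = f \<cdot> k'"
  shows "k = k'"
proof -
  define Z where "Z = Cod C g"
  have g: "g \<in> Hom C Y Z" using assms(1,2) by (auto simp: is_kernel_def Hom_def Z_def)
  have z: "g \<cdot> f = Nul C X Z" using assms(1,2) by (auto simp: is_kernel_def Hom_def Z_def)
  have W: "W \<in> Ob C" using assms Hom_Ob by blast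
  have "g \<cdot> (f \<cdot> k) = Nul C W Z"
    using Cmp_assoc[OF assms(3,2) g] z Cmp_Nul_left[OF assms(3)] Hom_Ob[OF g] by simp
  moreover have "f \<cdot> k \<in> Hom C W Y" using assms Cmp_closed by blast
  ultimately have "\<exists>!k'. k' \<in> Hom C W X \<and> f \<cdot> k' = f \<cdot> k"
    using assms(1) assms(2)[THEN Hom_D] g[THEN Hom_D] W unfolding is_kernel_def by auto
  then show ?thesis using assms by metis
qed

lemma cokernel_factor:
  assumes "is_cokernel C g f" "f \<in> Hom C X Y" "g \<in> Hom C Y Z" "h \<in> Hom C Y W" "h \<cdot> f = Nul C X W"
  obtains k where "k \<in> Hom C Z W" "k \<cdot> g = h"
  using preadditive_category.kernel_factor[OF preadditive_category_opposite, of g f Z Y X h W] assms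
  by auto

lemma cokernel_epi:
  assumes "is_cokernel C g f" "g \<in> Hom C Y Z" "k \<in> Hom C Z W" "k' \<in> Hom C Z W" "k \<cdot> g = k' \<cdot> g"
  shows "k = k'"
  using preadditive_category.kernel_mono[OF preadditive_category_opposite, of g f Z Y k W k'] assms
  by auto

text \<open>A pushout leaves the cokernel object unchanged: \<open>t\<close> is induced by the
  compatible pair consisting of \<open>g\<close> and the zero map. If \<open>w\<close> kills
  \<open>i'\<close>, then \<open>w \<cdot> h'\<close> kills \<open>i\<close> and factors through
  \<open>g\<close> by some \<open>s\<close>; now \<open>s \<cdot> t\<close> and \<open>w\<close>
  agree on both legs of the pushout, hence coincide.\<close>

lemma pushout_cokernel:
  assumes po: "is_pushout C i h i' h'" and ck: "is_cokernel C g i"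
  obtains t where "t \<in> Hom C (Cod C i') (Cod C g)" "t \<cdot> h' = g" "is_cokernel C t i'"
proof -
  define X Y X' Y' Z where "X = Dom C i" "Y = Cod C i" "X' = Dom C i'" "Y' = Cod C i'" "Z = Cod C g"
  note defs = this
  have arrs: "i \<in> Hom C X Y" "h \<in> Hom C X X'" "i' \<in> Hom C X' Y'" "h' \<in> Hom C Y Y'" "g \<in> Hom C Y Z"
    using po ck by (auto simp: is_pushout_def is_cokernel_def Hom_def defs)
  have comm: "h' \<cdot> i = i' \<cdot> h" using po by (simp add: is_pushout_def)
  have univ: "\<exists>!t. t \<in> Hom C Y' W \<and> t \<cdot> h' = u \<and> t \<cdot> i' = v"
    if "u \<in> Hom C Y W" "v \<in> Hom C X' W" "u \<cdot> i = v \<cdot> h" for W u v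
    using po that Hom_Ob(2)[OF that(1)] arrs[THEN Hom_D] unfolding is_pushout_def by auto
  have obs: "X \<in> Ob C" "X' \<in> Ob C" "Z \<in> Ob C" "Y \<in> Ob C" using arrs Hom_Ob by blast+
  have gi: "g \<cdot> i = Nul C X Z" using ck by (simp add: is_cokernel_def defs)
  have "g \<cdot> i = Nul C X' Z \<cdot> h"
    using gi Cmp_Nul_left[OF arrs(2) obs(3)] by simp
  then obtain t where t: "t \<in> Hom C Y' Z" "t \<cdot> h' = g" "t \<cdot> i' = Nul C X' Z"
    using univ[OF arrs(5) Nul_closed[OF obs(2,3)]] by blast
  have "\<exists>!k. k \<in> Hom C Z W \<and> k \<cdot> t = w"
    if w: "w \<in> Hom C Y' W" "w \<cdot> i' = Nul C X' W" for W w
  proof -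
    have W: "W \<in> Ob C" using w Hom_Ob by blast
    have wh: "w \<cdot> h' \<in> Hom C Y W" using w arrs Cmp_closed by blast
    have "w \<cdot> h' \<cdot> i = Nul C X W"
      using Cmp_assoc[OF arrs(1,4) w(1)] Cmp_assoc[OF arrs(2,3) w(1)] comm w(2)
        Cmp_Nul_left[OF arrs(2) W] by simp
    then obtain s where s: "s \<in> Hom C Z W" "s \<cdot> g = w \<cdot> h'"
      using cokernel_factor[OF ck arrs(1,5) wh] by blast
    have "s \<cdot> t \<in> Hom C Y' W" "s \<cdot> t \<cdot> h' = w \<cdot> h'" "s \<cdot> t \<cdot> i' = w \<cdot> i'"
      using Cmp_assoc[OF arrs(4) t(1) s(1)] Cmp_assoc[OF arrs(3) t(1) s(1)] t s w
        Cmp_Nul_right[OF s(1) obs(2)] Cmp_closed[OF t(1) s(1)] by simp_all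
    moreover have "w \<cdot> h' \<cdot> i = w \<cdot> i' \<cdot> h"
      using Cmp_assoc[OF arrs(1,4) w(1)] Cmp_assoc[OF arrs(2,3) w(1)] comm by simp
    ultimately have "s \<cdot> t = w"
      using univ[OF wh, of "w \<cdot> i'"] Cmp_closed[OF arrs(3) w(1)] w(1) by blast
    moreover have "k = s" if "k \<in> Hom C Z W" "k \<cdot> t = w" for k
      using cokernel_epi[OF ck arrs(5) that(1) s(1)] Cmp_assoc[OF arrs(4) t(1) that(1)] that t s
      by simp
    ultimately show ?thesis using s(1) by blast
  qed
  then have "is_cokernel C t i'"
    using t(1)[THEN Hom_D] t(3) arrs(3)[THEN Hom_D] unfolding is_cokernel_def by auto
  then show ?thesis using that t by (simp add: defs)
qed

lemma pullback_kernel: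
  assumes "is_pullback C d h d' h'" and "is_kernel C f d"
  obtains t where "t \<in> Hom C (Dom C f) (Dom C d')" "h' \<cdot> t = f" "is_kernel C t d'"
  using preadditive_category.pushout_cokernel[OF preadditive_category_opposite, of d h d' h' f] assms
  by auto

lemma Ide_isomorphism: "X \<in> Ob C \<Longrightarrow> isomorphism C X X (Ide C X)"
  using Ide_closed Ide_left unfolding isomorphism_def by blast

lemma cokernel_unique:
  assumes "is_cokernel C g f" "is_cokernel C g' f"
  obtains c where "isomorphism C (Cod C g) (Cod C g') c" "c \<cdot> g = g'"
proof -
  define X Y Z Z' where "X = Dom C f" "Y = Cod C f" "Z = Cod C g" "Z' = Cod C g'"
  note defs = this
  have f: "f \<in> Hom C X Y" and g: "g \<in> Hom C Y Z" and g': "g' \<in> Hom C Y Z'"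
    and z: "g \<cdot> f = Nul C X Z" "g' \<cdot> f = Nul C X Z'"
    using assms by (auto simp: is_cokernel_def Hom_def defs)
  obtain c where c: "c \<in> Hom C Z Z'" "c \<cdot> g = g'" using cokernel_factor[OF assms(1) f g g' z(2)] by blast
  obtain c' where c': "c' \<in> Hom C Z' Z" "c' \<cdot> g' = g" using cokernel_factor[OF assms(2) f g' g z(1)] by blast
  have "c' \<cdot> c \<cdot> g = Ide C Z \<cdot> g" "c \<cdot> c' \<cdot> g' = Ide C Z' \<cdot> g'"
    using Cmp_assoc[OF g c(1) c'(1)] Cmp_assoc[OF g' c'(1) c(1)] c c' g g' Ide_left by auto
  then have "c' \<cdot> c = Ide C Z" "c \<cdot> c' = Ide C Z'"
    using cokernel_epi[OF assms(1) g] cokernel_epi[OF assms(2) g'] c c' Cmp_closed Ide_closed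
      Hom_Ob[OF c(1)] by metis+
  then show ?thesis using that c c' unfolding isomorphism_def defs by blast
qed

lemma isomorphism_opposite [simp]: "isomorphism (opposite C) X Y f \<longleftrightarrow> isomorphism C Y X f"
  unfolding isomorphism_def by auto

lemma kernel_unique:
  assumes "is_kernel C f g" "is_kernel C f' g"
  obtains a where "isomorphism C (Dom C f') (Dom C f) a" "f \<cdot> a = f'"
  using preadditive_category.cokernel_unique[OF preadditive_category_opposite, of f g f'] assms
  by auto

section \<open>Biproducts and split pairs\<close>

lemma biproduct_swap:
  assumes "biproduct C X Y P i j p q" shows "biproduct C Y X P j i q p"
  using assms Add_commute[of "i \<cdot> p" P P "j \<cdot> q"] Cmp_closed unfolding biproduct_def by metis

text \<open>The comparison map is \<open>i' \<cdot> p \<boxplus> j' \<cdot> q\<close>, and its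
  inverse has the same shape with the roles exchanged. The auxiliary facts are therefore stated for
  an arbitrary pair of biproducts and instantiated in both orders.\<close>

lemma biproduct_iso_closed:
  assumes "biproduct C X Y P i j p q" "biproduct C X Y P' i' j' p' q'"
  shows "\<exists>h. isomorphism C P P' h \<and> h \<cdot> i = i' \<and> q' \<cdot> h = q"
proof -
  have comp: "(i' \<cdot> p \<boxplus> j' \<cdot> q) \<in> Hom C P P' \<and> (i' \<cdot> p \<boxplus> j' \<cdot> q) \<cdot> i = i' \<and>
      (i' \<cdot> p \<boxplus> j' \<cdot> q) \<cdot> j = j' \<and> q' \<cdot> (i' \<cdot> p \<boxplus> j' \<cdot> q) = q"
    if b: "biproduct C X Y P i j p q" "biproduct C X Y P' i' j' p' q'" for P i j p q P' i' j' p' q'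
  proof -
    have h: "i \<in> Hom C X P" "j \<in> Hom C Y P" "p \<in> Hom C P X" "q \<in> Hom C P Y"
      "i' \<in> Hom C X P'" "j' \<in> Hom C Y P'" "p' \<in> Hom C P' X" "q' \<in> Hom C P' Y"
      using b by (auto simp: biproduct_def)
    have e: "p \<cdot> i = Ide C X" "q \<cdot> j = Ide C Y" "p \<cdot> j = Nul C Y X" "q \<cdot> i = Nul C X Y"
       "q' \<cdot> j' = Ide C Y" "q' \<cdot> i' = Nul C X Y"
      using b by (auto simp: biproduct_def)
    have ob: "X \<in> Ob C" "Y \<in> Ob C" "P \<in> Ob C" "P' \<in> Ob C" using h Hom_Ob by blast+
    have ij: "i' \<cdot> p \<in> Hom C P P'" "j' \<cdot> q \<in> Hom C P P'" using h Cmp_closed by blast+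
    have "(i' \<cdot> p \<boxplus> j' \<cdot> q) \<cdot> i = i'"
      using Cmp_Add_left[OF h(1) ij] Cmp_assoc[OF h(1,3,5)] Cmp_assoc[OF h(1,4,6)] e
        Ide_right[OF h(5)] Cmp_Nul_right[OF h(6)] ob Add_Nul[OF h(5)] by simp
    moreover have "(i' \<cdot> p \<boxplus> j' \<cdot> q) \<cdot> j = j'"
      using Cmp_Add_left[OF h(2) ij] Cmp_assoc[OF h(2,3,5)] Cmp_assoc[OF h(2,4,6)] e
        Ide_right[OF h(6)] Cmp_Nul_right[OF h(5)] ob Add_Nul[OF h(6)] by simp
    moreover have "q' \<cdot> (i' \<cdot> p \<boxplus> j' \<cdot> q) = q"
      using Cmp_Add_right[OF ij h(8)] Cmp_assoc[OF h(3,5,8)] Cmp_assoc[OF h(4,6,8)] e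
        Ide_left[OF h(4)] Cmp_Nul_left[OF h(3)] ob Add_Nul[OF h(4)] by simp
    ultimately show ?thesis using Add_closed[OF ij] by simp
  qed
  have inv: "(i \<cdot> p' \<boxplus> j \<cdot> q') \<cdot> (i' \<cdot> p \<boxplus> j' \<cdot> q) = Ide C P"
    if b: "biproduct C X Y P i j p q" "biproduct C X Y P' i' j' p' q'" for P i j p q P' i' j' p' q'
  proof -
    have h: "i \<in> Hom C X P" "j \<in> Hom C Y P" "p \<in> Hom C P X" "q \<in> Hom C P Y"
      "i' \<in> Hom C X P'" "j' \<in> Hom C Y P'"
      and one: "i \<cdot> p \<boxplus> j \<cdot> q = Ide C P"
      using b by (auto simp: biproduct_def)
    let ?u = "i \<cdot> p' \<boxplus> j \<cdot> q'"
    have u: "?u \<in> Hom C P' P" "?u \<cdot> i' = i" "?u \<cdot> j' = j" using comp[OF b(2,1)] by auto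
    have "i' \<cdot> p \<in> Hom C P P'" "j' \<cdot> q \<in> Hom C P P'" using h Cmp_closed by blast+
    then show ?thesis
      using Cmp_Add_right[OF _ _ u(1)] Cmp_assoc[OF h(3,5) u(1)] Cmp_assoc[OF h(4,6) u(1)] u one
      by simp
  qed
  show ?thesis
    using comp[OF assms] comp[OF assms(2,1)] inv[OF assms] inv[OF assms(2,1)]
    unfolding isomorphism_def by blast
qed

text \<open>The idempotent complementary to \<open>s \<cdot> g\<close> is killed by
  \<open>g\<close>, so it factors through the kernel \<open>f\<close>; the factor \<open>r\<close>
  is the missing projection. The equations for \<open>r \<cdot> f\<close> and
  \<open>r \<cdot> s\<close> are checked after composing with the monomorphism
  \<open>f\<close>.\<close>

lemma split_pair_of_section:
  assumes k: "is_kernel C f g" and s: "s \<in> Hom C (Cod C g) (Dom C g)" "g \<cdot> s = Ide C (Cod C g)"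
  shows "split_pair C f g"
proof -
  define X Y Z where "X = Dom C f" "Y = Dom C g" "Z = Cod C g"
  note defs = this
  have f: "f \<in> Hom C X Y" and g: "g \<in> Hom C Y Z" and gf: "g \<cdot> f = Nul C X Z"
    using k by (auto simp: is_kernel_def Hom_def defs)
  have s: "s \<in> Hom C Z Y" "g \<cdot> s = Ide C Z" using s by (simp_all add: defs)
  have ob: "X \<in> Ob C" "Y \<in> Ob C" "Z \<in> Ob C" using f g Hom_Ob by blast+
  have sg: "s \<cdot> g \<in> Hom C Y Y" using s g Cmp_closed by blast
  \<comment> \<open>\<open>w\<close> plays the role of the identity minus
    \<open>s \<cdot> g\<close>.\<close>
  obtain w where w: "w \<in> Hom C Y Y" "Ide C Y = w \<boxplus> s \<cdot> g"
    using difference_ex[OF Ide_closed[OF ob(2)] sg] by blast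
  have "g = g \<cdot> w \<boxplus> g \<cdot> (s \<cdot> g)"
    using Cmp_Add_right[OF w(1) sg g] w(2) Ide_right[OF g] by simp
  also have "g \<cdot> (s \<cdot> g) = g" using Cmp_assoc[OF g s(1) g] s(2) Ide_left[OF g] by simp
  finally have "g \<cdot> w = Nul C Y Z" using Add_cancel[OF Cmp_closed[OF w(1) g] g] by simp
  then obtain r where r: "r \<in> Hom C Y X" "f \<cdot> r = w" using kernel_factor[OF k f g w(1)] by blast
  have one: "f \<cdot> r \<boxplus> s \<cdot> g = Ide C Y" using w r by simp
  have "f \<cdot> (r \<cdot> f) = f"
  proof -
    have "f = f \<cdot> r \<cdot> f \<boxplus> s \<cdot> g \<cdot> f"
      using Cmp_Add_left[OF f w(1) sg] one r Ide_left[OF f] by simp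
    also have "s \<cdot> g \<cdot> f = Nul C X Y" using Cmp_assoc[OF f g s(1)] gf Cmp_Nul_right[OF s(1) ob(1)] by simp
    also have "f \<cdot> r \<cdot> f \<boxplus> Nul C X Y = f \<cdot> r \<cdot> f" using Add_Nul Cmp_closed f r by metis
    finally show ?thesis using Cmp_assoc[OF f r(1) f] by simp
  qed
  then have rf: "r \<cdot> f = Ide C X"
    using kernel_mono[OF k f Cmp_closed[OF f r(1)] Ide_closed[OF ob(1)]] Ide_right[OF f] by simp
  have "f \<cdot> (r \<cdot> s) = Nul C Z Y"
  proof -
    have "s = f \<cdot> r \<cdot> s \<boxplus> s \<cdot> g \<cdot> s"
      using Cmp_Add_left[OF s(1) w(1) sg] one r Ide_left[OF s(1)] by simp
    also have "s \<cdot> g \<cdot> s = s" using Cmp_assoc[OF s(1) g s(1)] s(2) Ide_right[OF s(1)] by simp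
    finally have "f \<cdot> r \<cdot> s = Nul C Z Y"
      using Add_cancel[of "f \<cdot> r \<cdot> s" Z Y s] Cmp_closed s w r by metis
    then show ?thesis using Cmp_assoc[OF s(1) r(1) f] by simp
  qed
  then have "r \<cdot> s = Nul C Z X"
    using kernel_mono[OF k f Cmp_closed[OF s(1) r(1)] Nul_closed[OF ob(3,1)]] Cmp_Nul_right[OF f ob(3)]
    by simp
  moreover have "Cod C f = Y" "Dom C f = X" "Cod C g = Z" using f g Hom_D by blast+
  ultimately show ?thesis
    using f g s r rf gf one unfolding split_pair_def biproduct_def by auto
qed

lemma split_pair_section:
  assumes "split_pair C f g"
  obtains s where "s \<in> Hom C (Cod C g) (Cod C f)" "g \<cdot> s = Ide C (Cod C g)"
  using assms unfolding split_pair_def biproduct_def by blast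

text \<open>\<open>split_pair\<close> reads the middle object off the codomain of its first arrow,
  which on the opposite side is \<open>Dom C g\<close>; the hypothesis identifies the two
  readings.\<close>

lemma split_pair_opposite:
  assumes "Cod C f = Dom C g" shows "split_pair (opposite C) g f \<longleftrightarrow> split_pair C f g"
  using assms biproduct_swap unfolding split_pair_def by (auto; metis)

end

lemma (in additive_category) additive_category_opposite: "additive_category (opposite C)"
  by (intro additive_category.intro preadditive_category_opposite additive_category_axioms.intro)
    (use has_zero_object has_biproducts in \<open>simp_all, metis\<close>)

text \<open>Hom out of \<open>M\<close> is left exact on a kernel, so surjectivity at the right-hand
  end is all that remains of short exactness.\<close>

lemma (in preadditive_category) short_exact_Hom_iff:
  assumes k: "is_kernel C f g" and f: "f \<in> Hom C X Y" and g: "g \<in> Hom C Y Z" and M: "M \<in> Ob C"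
  shows "short_exact (Hom_group C M X) (Hom_group C M Y) (Hom_group C M Z) (\<lambda>h. f \<cdot> h) (\<lambda>h. g \<cdot> h)
    \<longleftrightarrow> (\<forall>h\<in>Hom C M Z. \<exists>k\<in>Hom C M Y. g \<cdot> k = h)"
proof -
  let ?G = "Hom_group C M"
  have carrier [simp]: "carrier (?G W) = Hom C M W" "\<one>\<^bsub>?G W\<^esub> = Nul C M W" for W
    by (simp_all add: Hom_group_def)
  have ob: "X \<in> Ob C" "Y \<in> Ob C" "Z \<in> Ob C" using f g Hom_Ob by blast+
  have grp: "group (?G X)" "group (?G Y)" "group (?G Z)"
    using ob M Hom_comm_group comm_group.axioms(2) by blast+
  have hom: "(\<lambda>h. u \<cdot> h) \<in> hom (?G V) (?G W)" if "u \<in> Hom C V W" for u V W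
    using that Cmp_closed[OF _ that] Cmp_Add_right[OF _ _ that] by (auto simp: hom_def Hom_group_def)
  have gf: "g \<cdot> f = Nul C X Z" using k f g by (auto simp: is_kernel_def Hom_def)
  have inj: "kernel (?G X) (?G Y) (\<lambda>h. f \<cdot> h) = {Nul C M X}"
  proof -
    have "h = Nul C M X" if "h \<in> Hom C M X" "f \<cdot> h = Nul C M Y" for h
      using kernel_mono[OF k f that(1) Nul_closed[OF M ob(1)]] that Cmp_Nul_right[OF f M] by simp
    then show ?thesis
      using Nul_closed[OF M ob(1)] Cmp_Nul_right[OF f M] unfolding kernel_def carrier by blast
  qed
  have mid: "kernel (?G Y) (?G Z) (\<lambda>h. g \<cdot> h) = (\<lambda>h. f \<cdot> h) ` Hom C M X"
  proof -
    have "g \<cdot> (f \<cdot> h) = Nul C M Z" if "h \<in> Hom C M X" for h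
      using Cmp_assoc[OF that f g] gf Cmp_Nul_left[OF that ob(3)] by simp
    moreover have "h \<in> (\<lambda>h. f \<cdot> h) ` Hom C M X" if "h \<in> Hom C M Y" "g \<cdot> h = Nul C M Z" for h
      using kernel_factor[OF k f g that] by blast
    ultimately show ?thesis using Cmp_closed[OF _ f] unfolding kernel_def carrier by blast
  qed
  \<comment> \<open>\<open>exact_seq\<close> is built up from one initial homomorphism; here that is
    the inclusion of the trivial group, whose image is the kernel found in
    \<open>inj\<close>.\<close>
  have left: "group_hom (singleton_group (Nul C M X)) (?G X) (\<lambda>_. Nul C M X)"
    using grp(1) trivial_hom[OF grp(1), of "singleton_group (Nul C M X)"]
    by (simp add: group_hom_def group_hom_axioms_def)
  have right: "kernel (?G Z) (singleton_group (Nul C M Z)) (\<lambda>_. Nul C M Z) = Hom C M Z"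
    by (simp add: kernel_def singleton_group_def)
  have "(\<forall>h\<in>Hom C M Z. \<exists>k\<in>Hom C M Y. g \<cdot> k = h) \<longleftrightarrow> Hom C M Z = (\<lambda>h. g \<cdot> h) ` Hom C M Y"
    using Cmp_closed[OF _ g] by auto
  then show ?thesis
    unfolding short_exact_def using grp hom[OF f] hom[OF g] inj mid left right
    by simp
qed

section \<open>Closure properties of orthogonals\<close>

lemma left_perp_antimono: "\<B> \<subseteq> \<B>' \<Longrightarrow> left_perp C D \<B>' \<subseteq> left_perp C D \<B>"
  unfolding left_perp_def by blast

lemma right_perp_antimono: "\<A> \<subseteq> \<A>' \<Longrightarrow> right_perp C D \<A>' \<subseteq> right_perp C D \<A>"
  unfolding right_perp_def by blast

lemma perp_closure:
  "\<A> \<subseteq> Ob C \<Longrightarrow> \<A> \<subseteq> left_perp C D (right_perp C D \<A>)"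
  "\<B> \<subseteq> Ob C \<Longrightarrow> \<B> \<subseteq> right_perp C D (left_perp C D \<B>)"
  unfolding left_perp_def right_perp_def by blast+

lemma perp_Ob: "left_perp C D \<A> \<subseteq> Ob C" "right_perp C D \<A> \<subseteq> Ob C"
  unfolding left_perp_def right_perp_def by blast+

text \<open>Taking orthogonals three times is the same as taking them once, as for any antitone pair
  of maps whose double composites are extensive.\<close>

lemma cotorsion_pair_generated:
  assumes "\<M> \<subseteq> Ob C"
  shows "(left_perp C D (right_perp C D \<M>), right_perp C D \<M>) \<in> cotorsion_pairs C D"
proof -
  have "right_perp C D (left_perp C D (right_perp C D \<M>)) = right_perp C D \<M>"
    by (intro subset_antisym right_perp_antimono perp_closure perp_Ob assms)
  then show ?thesis by (simp add: cotorsion_pairs_def perp_Ob)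
qed

lemma cotorsion_pair_cogenerated:
  assumes "\<M> \<subseteq> Ob C"
  shows "(left_perp C D \<M>, right_perp C D (left_perp C D \<M>)) \<in> cotorsion_pairs C D"
proof -
  have "left_perp C D (right_perp C D (left_perp C D \<M>)) = left_perp C D \<M>"
    by (intro subset_antisym left_perp_antimono perp_closure perp_Ob assms)
  then show ?thesis by (simp add: cotorsion_pairs_def perp_Ob)
qed


section \<open>The self-dual part of the axioms of an exact structure\<close>

text \<open>Keller's axioms are not symmetric: closure of inflations under composition is a consequence
  of them. Omitting closure under composition leaves a notion that passes to the opposite category
  trivially and still suffices for the theory of extensions.\<close>

locale preexact_structure = additive_category C for C (structure) +
  fixes E :: "('b \<times> 'b) set"
  assumes conflation: "(f, g) \<in> E \<Longrightarrow> is_kernel C f g \<and> is_cokernel C g f"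
    and kernel_closed: "\<lbrakk>(f, g) \<in> E; is_kernel C f' g\<rbrakk> \<Longrightarrow> (f', g) \<in> E"
    and cokernel_closed: "\<lbrakk>(f, g) \<in> E; is_cokernel C g' f\<rbrakk> \<Longrightarrow> (f, g') \<in> E"
    and biproduct_conflation: "biproduct C X Y P i j p q \<Longrightarrow> (i, q) \<in> E"
    and pullback_ex:
      "\<lbrakk>deflation E d; h \<in> Arr C; Cod C h = Cod C d\<rbrakk> \<Longrightarrow> \<exists>d' h'. is_pullback C d h d' h'"
    and pullback_deflation: "\<lbrakk>deflation E d; is_pullback C d h d' h'\<rbrakk> \<Longrightarrow> deflation E d'"
    and pushout_ex:
      "\<lbrakk>inflation E i; h \<in> Arr C; Dom C h = Dom C i\<rbrakk> \<Longrightarrow> \<exists>i' h'. is_pushout C i h i' h'"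
    and pushout_inflation: "\<lbrakk>inflation E i; is_pushout C i h i' h'\<rbrakk> \<Longrightarrow> inflation E i'"
begin

lemma preexact_structure_opposite: "preexact_structure (opposite C) (E\<inverse>)"
proof (intro preexact_structure.intro additive_category_opposite preexact_structure_axioms.intro)
  fix X Y P i j p q
  assume "biproduct (opposite C) X Y P i j p q"
  then show "(i, q) \<in> E\<inverse>" using biproduct_conflation[OF biproduct_swap] by simp
qed (simp_all, (blast dest: conflation intro: kernel_closed cokernel_closed pullback_ex pushout_ex
    pullback_deflation pushout_inflation)+)

lemma conflation_Hom:
  assumes "(f, g) \<in> E"
  obtains X Y Z where "f \<in> Hom C X Y" "g \<in> Hom C Y Z" "g \<cdot> f = Nul C X Z"
  using conflation[OF assms] unfolding is_kernel_def Hom_def by auto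

section \<open>Generated classes as lifting and extension conditions\<close>

lemma proj_generated_iff:
  assumes "\<M> \<subseteq> Ob C"
  shows "(f, g) \<in> proj_generated C E \<M> \<longleftrightarrow>
    (f, g) \<in> E \<and> (\<forall>M\<in>\<M>. \<forall>h\<in>Hom C M (Cod C g). \<exists>k\<in>Hom C M (Dom C g). g \<cdot> k = h)"
proof (cases "(f, g) \<in> E")
  case True
  then obtain X Y Z where fg: "f \<in> Hom C X Y" "g \<in> Hom C Y Z" using conflation_Hom by metis
  have "is_kernel C f g" using conflation True by blast
  from short_exact_Hom_iff[OF this fg]
  have "\<forall>M\<in>\<M>. short_exact (Hom_group C M X) (Hom_group C M Y) (Hom_group C M Z) (\<lambda>h. f \<cdot> h) (\<lambda>h. g \<cdot> h)
    \<longleftrightarrow> (\<forall>h\<in>Hom C M Z. \<exists>k\<in>Hom C M Y. g \<cdot> k = h)"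
    using assms by blast
  then show ?thesis using True fg[THEN Hom_D] by (simp add: proj_generated_def)
qed (simp add: proj_generated_def)

lemma proj_generated_opposite:
  "proj_generated (opposite C) (E\<inverse>) \<M> = (inj_generated C E \<M>)\<inverse>"
proof -
  have "Cod C f = Dom C g" if "(f, g) \<in> E" for f g
    using conflation[OF that] unfolding is_kernel_def by auto
  then show ?thesis unfolding proj_generated_def inj_generated_def by fastforce
qed

lemma inj_generated_iff:
  assumes "\<M> \<subseteq> Ob C"
  shows "(f, g) \<in> inj_generated C E \<M> \<longleftrightarrow>
    (f, g) \<in> E \<and> (\<forall>M\<in>\<M>. \<forall>h\<in>Hom C (Dom C f) M. \<exists>k\<in>Hom C (Cod C f) M. k \<cdot> f = h)"
  using preexact_structure.proj_generated_iff[OF preexact_structure_opposite, of \<M> g f] assms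
  by (simp add: proj_generated_opposite)

text \<open>Being an inflation guarantees some cokernel in the class; this lets any prescribed
  cokernel take its place.\<close>

lemma inflation_conflation:
  assumes "inflation E f" "is_cokernel C g f" shows "(f, g) \<in> E"
  using assms cokernel_closed unfolding inflation_def by blast

lemma deflation_conflation:
  assumes "deflation E g" "is_kernel C f g" shows "(f, g) \<in> E"
  using assms kernel_closed unfolding deflation_def by blast

text \<open>This is the contravariant action of \<open>h\<close> on extensions: the deflation is
  pulled back, while the left-hand object stays the same because a pullback has the same kernel
  object.\<close>

lemma pullback_conflation:
  assumes fg: "(f, g) \<in> E" and h: "h \<in> Hom C W (Cod C g)"
  obtains f' g' h' where "(f', g') \<in> E" "Dom C f' = Dom C f" "h' \<in> Hom C (Dom C g') (Dom C g)"
    "g' \<in> Hom C (Dom C g') W" "g \<cdot> h' = h \<cdot> g'"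
proof -
  have "deflation E g" using fg unfolding deflation_def by blast
  then obtain g' h' where pb: "is_pullback C g h g' h'" using pullback_ex h Hom_D by metis
  obtain f' where f': "f' \<in> Hom C (Dom C f) (Dom C g')" "is_kernel C f' g'"
    using pullback_kernel[OF pb] conflation[OF fg] by blast
  have "(f', g') \<in> E"
    using deflation_conflation[OF pullback_deflation[OF \<open>deflation E g\<close> pb] f'(2)] .
  then show ?thesis
    using that[of f' g' h'] f'(1) pb Hom_D[OF f'(1)] Hom_D[OF h] unfolding is_pullback_def
    by (auto simp: Hom_def)
qed

text \<open>The lifting property depends only on the deflation and survives each operation: a change
  of cokernel is composition with an isomorphism, a biproduct projection has a section, and lifts
  pass along pullback and pushout squares.\<close>

lemma proj_generated_preexact:
  assumes M: "\<M> \<subseteq> Ob C" shows "preexact_structure C (proj_generated C E \<M>)"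
proof -
  let ?P = "proj_generated C E \<M>"
  have sub: "(f, g) \<in> ?P \<Longrightarrow> (f, g) \<in> E" for f g
    by (simp add: proj_generated_def)
  have lift: "\<exists>k\<in>Hom C M (Dom C g). g \<cdot> k = h"
    if "(f, g) \<in> ?P" "M \<in> \<M>" "h \<in> Hom C M (Cod C g)" for f g M h
    using that proj_generated_iff[OF assms] by simp
  have memI: "(f, g) \<in> ?P"
    if "(f, g) \<in> E"
      "\<And>M h. M \<in> \<M> \<Longrightarrow> h \<in> Hom C M (Cod C g) \<Longrightarrow> \<exists>k\<in>Hom C M (Dom C g). g \<cdot> k = h" for f g
    using that proj_generated_iff[OF assms] by simp
  have infl: "inflation ?P f \<Longrightarrow> inflation E f" and defl: "deflation ?P f \<Longrightarrow> deflation E f" for f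
    using sub unfolding inflation_def deflation_def by blast+
  show ?thesis
  proof (intro preexact_structure.intro additive_category_axioms preexact_structure_axioms.intro)
    fix f g assume fg: "(f, g) \<in> ?P"
    then show "is_kernel C f g \<and> is_cokernel C g f" using conflation sub by blast
    show "(f', g) \<in> ?P" if "is_kernel C f' g" for f' using memI[OF kernel_closed[OF sub[OF fg] that] lift[OF fg]] .
  next
    fix f g g' assume fg: "(f, g) \<in> ?P" and g': "is_cokernel C g' f"
    have E: "(f, g') \<in> E" using cokernel_closed[OF sub[OF fg] g'] .
    obtain c where c: "isomorphism C (Cod C g) (Cod C g') c" "c \<cdot> g = g'"
      using cokernel_unique[OF _ g'] conflation[OF sub[OF fg]] by blast
    have g: "g \<in> Hom C (Dom C g) (Cod C g)" "Dom C g' = Dom C g"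
      using conflation[OF sub[OF fg]] g' unfolding is_kernel_def is_cokernel_def Hom_def by auto
    from c(1) obtain d where d: "d \<in> Hom C (Cod C g') (Cod C g)" "c \<cdot> d = Ide C (Cod C g')"
      and c': "c \<in> Hom C (Cod C g) (Cod C g')" unfolding isomorphism_def by blast
    have "\<exists>k\<in>Hom C M (Dom C g'). g' \<cdot> k = h" if h: "M \<in> \<M>" "h \<in> Hom C M (Cod C g')" for M h
    proof -
      \<comment> \<open>The inverse \<open>d\<close> of \<open>c\<close> carries \<open>h\<close>
        back to the codomain of \<open>g\<close>, where a lift is available.\<close>
      obtain k where k: "k \<in> Hom C M (Dom C g)" "g \<cdot> k = d \<cdot> h"
        using lift[OF fg h(1) Cmp_closed[OF h(2) d(1)]] by blast
      have "g' \<cdot> k = h"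
        using Cmp_assoc[OF k(1) g(1) c'] Cmp_assoc[OF h(2) d(1) c'] k(2) c(2) d(2)
          Ide_left[OF h(2)] by simp
      then show ?thesis using k g by auto
    qed
    then show "(f, g') \<in> ?P" using memI[OF E] by blast
  next
    fix X Y P i j p q assume b: "biproduct C X Y P i j p q"
    then have h: "q \<in> Hom C P Y" "j \<in> Hom C Y P" "q \<cdot> j = Ide C Y" by (auto simp: biproduct_def)
    have "\<exists>k\<in>Hom C M P. q \<cdot> k = h" if "h \<in> Hom C M Y" for M h
      using Cmp_assoc[OF that h(2,1)] h(3) Ide_left[OF that] Cmp_closed[OF that h(2)] by metis
    then show "(i, q) \<in> ?P" using memI[OF biproduct_conflation[OF b]] Hom_D[OF h(1)] by simp
  next
    fix d h assume "deflation ?P d" "h \<in> Arr C" "Cod C h = Cod C d"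
    then show "\<exists>d' h'. is_pullback C d h d' h'" using pullback_ex defl by blast
  next
    fix d h d' h' assume d: "deflation ?P d" and pb: "is_pullback C d h d' h'"
    obtain f' where f': "(f', d') \<in> E"
      using pullback_deflation[OF defl[OF d] pb] unfolding deflation_def by blast
    have "\<exists>k\<in>Hom C M (Dom C d'). d' \<cdot> k = u" if u: "M \<in> \<M>" "u \<in> Hom C M (Cod C d')" for M u
    proof -
      have arrs: "h \<in> Hom C (Cod C d') (Cod C d)" "Cod C d' = Dom C h"
        using pb by (auto simp: is_pullback_def Hom_def)
      \<comment> \<open>The lift \<open>v\<close> of \<open>h \<cdot> u\<close> and \<open>u\<close>
        itself form a cone over the pullback square; the induced map is the lift of
        \<open>u\<close>.\<close>
      obtain v where v: "v \<in> Hom C M (Dom C d)" "d \<cdot> v = h \<cdot> u"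
        using d lift[OF _ u(1) Cmp_closed[OF u(2) arrs(1)]] unfolding deflation_def by blast
      moreover have "M \<in> Ob C" "u \<in> Hom C M (Dom C h)" using u M arrs(2) by auto
      ultimately show ?thesis using pb unfolding is_pullback_def by blast
    qed
    then show "deflation ?P d'" using memI[OF f'] unfolding deflation_def by blast
  next
    fix i h assume "inflation ?P i" "h \<in> Arr C" "Dom C h = Dom C i"
    then show "\<exists>i' h'. is_pushout C i h i' h'" using pushout_ex infl by blast
  next
    fix i h i' h' assume i: "inflation ?P i" and po: "is_pushout C i h i' h'"
    obtain g where ig: "(i, g) \<in> ?P" using i unfolding inflation_def by blast
    then obtain t where t: "t \<in> Hom C (Cod C i') (Cod C g)" "t \<cdot> h' = g" "is_cokernel C t i'"
      using pushout_cokernel[OF po] conflation sub by blast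
    have E: "(i', t) \<in> E" using inflation_conflation pushout_inflation infl[OF i] po t by blast
    have h': "h' \<in> Hom C (Dom C g) (Cod C i')"
      using po conflation[OF sub[OF ig]] by (auto simp: is_pushout_def is_kernel_def Hom_def)
    have "\<exists>k\<in>Hom C M (Dom C t). t \<cdot> k = u" if u: "M \<in> \<M>" "u \<in> Hom C M (Cod C t)" for M u
    proof -
      \<comment> \<open>The pushout has the same cokernel object and
        \<open>t \<cdot> h' = g\<close>, so a lift through \<open>g\<close> followed by
        \<open>h'\<close> is a lift through \<open>t\<close>.\<close>
      obtain v where v: "v \<in> Hom C M (Dom C g)" "g \<cdot> v = u"
        using lift[OF ig u(1)] u(2) Hom_D[OF t(1)] by auto
      have "t \<cdot> (h' \<cdot> v) = u" using Cmp_assoc[OF v(1) h' t(1)] t v by simp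
      then show ?thesis using Cmp_closed[OF v(1) h'] Hom_D[OF t(1)] by auto
    qed
    then show "inflation ?P i'" using memI[OF E] unfolding inflation_def by blast
  qed
qed

lemma inj_generated_preexact:
  assumes "\<M> \<subseteq> Ob C" shows "preexact_structure C (inj_generated C E \<M>)"
  using preexact_structure.preexact_structure_opposite[OF
      preexact_structure.proj_generated_preexact[OF preexact_structure_opposite, of \<M>]] assms
  by (simp add: proj_generated_opposite)


section \<open>Orthogonality\<close>

text \<open>In one direction a pair lies in its own class, which by hypothesis consists of split
  pairs. In the other, any two split extensions with the same ends are equivalent by comparison of
  biproducts, so there is only one class.\<close>

lemma Ext1_zero_iff:
  assumes "X \<in> Ob C" "A \<in> Ob C"
  shows "Ext1 C E A X = {Ext1_zero C E A X} \<longleftrightarrow>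
    (\<forall>f g. (f, g) \<in> E \<longrightarrow> Dom C f = X \<longrightarrow> Cod C g = A \<longrightarrow> split_pair C f g)"
proof
  assume zero: "Ext1 C E A X = {Ext1_zero C E A X}"
  show "\<forall>f g. (f, g) \<in> E \<longrightarrow> Dom C f = X \<longrightarrow> Cod C g = A \<longrightarrow> split_pair C f g"
  proof (intro allI impI)
    fix f g assume fg: "(f, g) \<in> E" "Dom C f = X" "Cod C g = A"
    then have ext: "(f, g) \<in> extensions C E A X" by (simp add: extensions_def)
    obtain X' Y Z where h: "f \<in> Hom C X' Y" "g \<in> Hom C Y Z" using conflation_Hom fg by metis
    have "((f, g), (f, g)) \<in> yoneda_equiv C E A X"
      using ext Ide_isomorphism[OF Hom_Ob(2)[OF h(1)]] Ide_left[OF h(1)] Ide_right[OF h(2)] Hom_D[OF h(1)]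
      unfolding yoneda_equiv_def by blast
    moreover have "yoneda_equiv C E A X `` {(f, g)} = Ext1_zero C E A X"
      using quotientI[OF ext, of "yoneda_equiv C E A X"] zero by (simp add: Ext1_def)
    ultimately have "(f, g) \<in> Ext1_zero C E A X" by blast
    then show "split_pair C f g" by (simp add: Ext1_zero_def)
  qed
next
  assume split: "\<forall>f g. (f, g) \<in> E \<longrightarrow> Dom C f = X \<longrightarrow> Cod C g = A \<longrightarrow> split_pair C f g"
  have zero: "Ext1_zero C E A X = extensions C E A X"
    using split by (auto simp: Ext1_zero_def extensions_def)
  have "((f, g), (f', g')) \<in> yoneda_equiv C E A X"
    if ext: "(f, g) \<in> extensions C E A X" "(f', g') \<in> extensions C E A X" for f g f' g'
  proof -
    have d: "Dom C f = X" "Cod C g = A" "Dom C f' = X" "Cod C g' = A"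
      using ext by (auto simp: extensions_def)
    obtain s r s' r' where "biproduct C X A (Cod C f) f s r g" "biproduct C X A (Cod C f') f' s' r' g'"
      using ext split d by (fastforce simp: extensions_def split_pair_def)
    from biproduct_iso_closed[OF this] show ?thesis using ext unfolding yoneda_equiv_def by blast
  qed
  then have "extensions C E A X \<times> extensions C E A X \<subseteq> yoneda_equiv C E A X"
    by (simp add: subset_iff split_paired_all)
  moreover have "yoneda_equiv C E A X \<subseteq> extensions C E A X \<times> extensions C E A X"
    by (auto simp: yoneda_equiv_def)
  ultimately have "yoneda_equiv C E A X `` {e} = extensions C E A X" if "e \<in> extensions C E A X" for e
    using that by blast
  \<comment> \<open>Without an extension the quotient would be empty rather than a singleton; the
    biproduct conflation supplies one.\<close>
  moreover have "extensions C E A X \<noteq> {}"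
  proof -
    obtain P i j p q where b: "biproduct C X A P i j p q" using has_biproducts assms by blast
    then have "i \<in> Hom C X P" "q \<in> Hom C P A" by (simp_all add: biproduct_def)
    then have "(i, q) \<in> extensions C E A X"
      using biproduct_conflation[OF b] by (simp add: extensions_def Hom_def)
    then show ?thesis by blast
  qed
  ultimately show "Ext1 C E A X = {Ext1_zero C E A X}"
    unfolding zero Ext1_def quotient_def by auto
qed

lemma right_perp_iff:
  assumes "\<A> \<subseteq> Ob C"
  shows "X \<in> right_perp C E \<A> \<longleftrightarrow> X \<in> Ob C \<and>
    (\<forall>f g. (f, g) \<in> E \<longrightarrow> Dom C f = X \<longrightarrow> Cod C g \<in> \<A> \<longrightarrow> split_pair C f g)"
proof (cases "X \<in> Ob C")
  case True
  then have "(\<forall>A\<in>\<A>. Ext1 C E A X = {Ext1_zero C E A X}) \<longleftrightarrow>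
      (\<forall>A\<in>\<A>. \<forall>f g. (f, g) \<in> E \<longrightarrow> Dom C f = X \<longrightarrow> Cod C g = A \<longrightarrow> split_pair C f g)"
    by (intro ball_cong[OF refl Ext1_zero_iff]) (use assms in auto)
  then show ?thesis using True by (auto simp: right_perp_def)
qed (simp add: right_perp_def)

lemma left_perp_iff:
  assumes "\<B> \<subseteq> Ob C"
  shows "X \<in> left_perp C E \<B> \<longleftrightarrow> X \<in> Ob C \<and>
    (\<forall>f g. (f, g) \<in> E \<longrightarrow> Cod C g = X \<longrightarrow> Dom C f \<in> \<B> \<longrightarrow> split_pair C f g)"
proof (cases "X \<in> Ob C")
  case True
  then have "(\<forall>B\<in>\<B>. Ext1 C E X B = {Ext1_zero C E X B}) \<longleftrightarrow>
      (\<forall>B\<in>\<B>. \<forall>f g. (f, g) \<in> E \<longrightarrow> Dom C f = B \<longrightarrow> Cod C g = X \<longrightarrow> split_pair C f g)"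
    by (intro ball_cong[OF refl Ext1_zero_iff]) (use assms in auto)
  then show ?thesis using True by (auto simp: left_perp_def)
qed (simp add: left_perp_def)

lemma right_perp_opposite:
  assumes "\<B> \<subseteq> Ob C" shows "right_perp (opposite C) (E\<inverse>) \<B> = left_perp C E \<B>"
proof -
  have "split_pair (opposite C) g f \<longleftrightarrow> split_pair C f g" if "(f, g) \<in> E" for f g
    using split_pair_opposite conflation[OF that] unfolding is_kernel_def by blast
  then show ?thesis
    using preexact_structure.right_perp_iff[OF preexact_structure_opposite, of \<B>] assms
    by (auto simp: left_perp_iff)
qed

lemma divisible_proj_generated:
  assumes M: "\<M> \<subseteq> Ob C"
  shows "divisible C E (proj_generated C E \<M>) = right_perp C E \<M>"
proof (intro subset_antisym subsetI)
  fix X assume X: "X \<in> divisible C E (proj_generated C E \<M>)"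
  interpret P: preexact_structure C "proj_generated C E \<M>" using proj_generated_preexact[OF M] .
  have "split_pair C f g" if fg: "(f, g) \<in> E" "Dom C f = X" "Cod C g \<in> \<M>" for f g
  proof -
    have "inflation (proj_generated C E \<M>) f"
      using X fg unfolding divisible_def inflation_def by blast
    \<comment> \<open>Divisibility only provides some cokernel of \<open>f\<close> in the generated
      class; closure under change of cokernel brings back the given \<open>g\<close>.\<close>
    then have "(f, g) \<in> proj_generated C E \<M>" using P.inflation_conflation conflation fg by blast
    \<comment> \<open>The identity of \<open>Cod C g\<close>, an object of \<open>\<M>\<close>, is
      lifted through \<open>g\<close>.\<close>
    then obtain s where "s \<in> Hom C (Cod C g) (Dom C g)" "g \<cdot> s = Ide C (Cod C g)"
      using proj_generated_iff[OF M] fg(3) Ide_closed M by blast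
    then show ?thesis using split_pair_of_section conflation fg by blast
  qed
  then show "X \<in> right_perp C E \<M>" using X unfolding right_perp_iff[OF M] divisible_def by blast
next
  fix X assume X: "X \<in> right_perp C E \<M>"
  have "inflation (proj_generated C E \<M>) f" if f: "inflation E f" "Dom C f = X" for f
  proof -
    obtain g where fg: "(f, g) \<in> E" using f unfolding inflation_def by blast
    then have g: "g \<in> Hom C (Dom C g) (Cod C g)"
      using conflation unfolding is_kernel_def Hom_def by blast
    have "\<exists>k\<in>Hom C M (Dom C g). g \<cdot> k = h" if h: "M \<in> \<M>" "h \<in> Hom C M (Cod C g)" for M h
    proof -
      obtain f' g' h' where pb: "(f', g') \<in> E" "Dom C f' = X" "h' \<in> Hom C (Dom C g') (Dom C g)"
        "g' \<in> Hom C (Dom C g') M" "g \<cdot> h' = h \<cdot> g'"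
        using pullback_conflation[OF fg h(2)] f(2) by metis
      have "split_pair C f' g'" using X pb h(1) Hom_D[OF pb(4)] unfolding right_perp_iff[OF M] by blast
      moreover have "Cod C f' = Dom C g'" using conflation[OF pb(1)] by (simp add: is_kernel_def)
      ultimately obtain s where s: "s \<in> Hom C M (Dom C g')" "g' \<cdot> s = Ide C M"
        using split_pair_section Hom_D[OF pb(4)] by metis
      \<comment> \<open>A section of the pulled-back deflation, followed by the projection
        \<open>h'\<close> of the square, is a lift of \<open>h\<close>.\<close>
      have "g \<cdot> (h' \<cdot> s) = h"
        using Cmp_assoc[OF s(1) pb(3) g] Cmp_assoc[OF s(1) pb(4) h(2)] pb(5) s(2) Ide_right[OF h(2)]
        by simp
      then show ?thesis using Cmp_closed[OF s(1) pb(3)] by blast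
    qed
    then show ?thesis using fg proj_generated_iff[OF M] unfolding inflation_def by blast
  qed
  then show "X \<in> divisible C E (proj_generated C E \<M>)"
    using X unfolding divisible_def right_perp_iff[OF M] by blast
qed

lemma flat_inj_generated:
  assumes "\<M> \<subseteq> Ob C"
  shows "flat C E (inj_generated C E \<M>) = left_perp C E \<M>"
  using preexact_structure.divisible_proj_generated[OF preexact_structure_opposite, of \<M>] assms
  by (simp add: proj_generated_opposite right_perp_opposite)

end

section \<open>Generated exact structures\<close>

context preexact_structure
begin

text \<open>On a zero object the identity is the zero map, so \<open>N\<close> is the biproduct of
  \<open>N\<close> with itself, all four structure maps being identities.\<close>

lemma zero_object_Ide_deflation:
  assumes N: "zero_object C N" shows "deflation E (Ide C N)"
proof -
  have ob: "N \<in> Ob C" using N by (simp add: zero_object_def)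
  note n = Nul_closed[OF ob ob] and i = Ide_closed[OF ob]
  have "Nul C N N = Ide C N" using N ob n i unfolding zero_object_def by blast
  then have "biproduct C N N N (Ide C N) (Ide C N) (Ide C N) (Ide C N)"
    using i Ide_left[OF i] Add_Nul[OF n] by (simp add: biproduct_def)
  then show ?thesis using biproduct_conflation unfolding deflation_def by blast
qed

text \<open>The square formed by two isomorphisms is a pullback.\<close>

lemma deflation_iso_closed:
  assumes d: "deflation E g" and b: "isomorphism C (Dom C g) Y b" and c: "isomorphism C (Cod C g) Z c"
    and g': "g' \<in> Hom C Y Z" and comm: "g' \<cdot> b = c \<cdot> g"
  shows "deflation E g'"
proof -
  have g: "g \<in> Hom C (Dom C g) (Cod C g)"
    using d conflation unfolding deflation_def is_kernel_def Hom_def by blast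
  obtain b' where b: "b \<in> Hom C (Dom C g) Y" "b' \<in> Hom C Y (Dom C g)"
      "b' \<cdot> b = Ide C (Dom C g)" "b \<cdot> b' = Ide C Y"
    using b unfolding isomorphism_def by blast
  obtain c' where c: "c \<in> Hom C (Cod C g) Z" "c' \<in> Hom C Z (Cod C g)"
      "c' \<cdot> c = Ide C (Cod C g)" "c \<cdot> c' = Ide C Z"
    using c unfolding isomorphism_def by blast
  have "c \<cdot> (g \<cdot> b') = g'"
    using Cmp_assoc[OF b(2) g c(1)] Cmp_assoc[OF b(2,1) g'] comm b(4) Ide_right[OF g'] by simp
  then have sq: "g \<cdot> b' = c' \<cdot> g'"
    using Cmp_assoc[OF Cmp_closed[OF b(2) g] c(1,2)] c(3) Ide_left[OF Cmp_closed[OF b(2) g]] by simp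
  have "\<exists>!t. t \<in> Hom C W Y \<and> b' \<cdot> t = u \<and> g' \<cdot> t = v"
    if u: "u \<in> Hom C W (Dom C g)" and v: "v \<in> Hom C W Z" and uv: "g \<cdot> u = c' \<cdot> v" for W u v
  proof (rule ex1I[of _ "b \<cdot> u"])
    show "b \<cdot> u \<in> Hom C W Y \<and> b' \<cdot> (b \<cdot> u) = u \<and> g' \<cdot> (b \<cdot> u) = v"
      using Cmp_closed[OF u b(1)] Cmp_assoc[OF u b(1,2)] Cmp_assoc[OF u b(1) g']
        Cmp_assoc[OF u g c(1)] Cmp_assoc[OF v c(2,1)] b(3) c(4) uv comm Ide_left[OF u] Ide_left[OF v]
      by simp
    show "t = b \<cdot> u" if "t \<in> Hom C W Y \<and> b' \<cdot> t = u \<and> g' \<cdot> t = v" for t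
      using that Cmp_assoc[of t W Y b' _ b] b Ide_left by metis
  qed
  then have "is_pullback C g c' g' b'"
    using Hom_D[OF g] Hom_D[OF b(2)] Hom_D[OF c(2)] Hom_D[OF g'] sq unfolding is_pullback_def by auto
  then show ?thesis using pullback_deflation d by blast
qed

end

text \<open>If \<open>w\<close> kills \<open>i\<close>, expanding the identity of \<open>P\<close>
  gives \<open>w = w \<cdot> j \<cdot> q\<close>; the factor is unique because \<open>j\<close> is a
  section of \<open>q\<close>.\<close>

lemma (in preadditive_category) biproduct_cokernel:
  assumes "biproduct C X Y P i j p q" shows "is_cokernel C q i"
proof -
  have h: "i \<in> Hom C X P" "j \<in> Hom C Y P" "p \<in> Hom C P X" "q \<in> Hom C P Y"
    and e: "q \<cdot> j = Ide C Y" "q \<cdot> i = Nul C X Y" "i \<cdot> p \<boxplus> j \<cdot> q = Ide C P"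
    using assms by (auto simp: biproduct_def)
  have ip: "i \<cdot> p \<in> Hom C P P" "j \<cdot> q \<in> Hom C P P" using h Cmp_closed by blast+
  have "\<exists>!k. k \<in> Hom C Y W \<and> k \<cdot> q = w" if w: "w \<in> Hom C P W" "w \<cdot> i = Nul C X W" for W w
  proof (rule ex1I[of _ "w \<cdot> j"])
    have wjq: "w \<cdot> (j \<cdot> q) \<in> Hom C P W" using Cmp_closed[OF ip(2) w(1)] .
    have "w = w \<cdot> (i \<cdot> p) \<boxplus> w \<cdot> (j \<cdot> q)"
      using Cmp_Add_right[OF ip w(1)] e(3) Ide_right[OF w(1)] by simp
    also have "w \<cdot> (i \<cdot> p) = Nul C P W"
      using Cmp_assoc[OF h(3,1) w(1)] w(2) Cmp_Nul_left[OF h(3)] Hom_Ob[OF w(1)] by simp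
    also have "Nul C P W \<boxplus> w \<cdot> (j \<cdot> q) = w \<cdot> j \<cdot> q"
      using Add_Nul[OF wjq] Cmp_assoc[OF h(4,2) w(1)] by simp
    finally show "w \<cdot> j \<in> Hom C Y W \<and> w \<cdot> j \<cdot> q = w" using Cmp_closed[OF h(2) w(1)] by simp
    show "k = w \<cdot> j" if "k \<in> Hom C Y W \<and> k \<cdot> q = w" for k
      using that Cmp_assoc[OF h(2,4), of k W] e(1) Ide_right by metis
  qed
  then show ?thesis using h(1,4)[THEN Hom_D] e(2) unfolding is_cokernel_def by auto
qed

section \<open>From Keller's axioms to the self-dual ones\<close>

context exact_structure
begin

text \<open>The identity of \<open>Z\<close> is the pullback, along the map from \<open>Z\<close> to
  a zero object, of the identity of that zero object.\<close>

lemma Ide_deflation: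
  assumes Z: "Z \<in> Ob C" shows "deflation E (Ide C Z)"
proof -
  obtain N where N: "zero_object C N" using has_zero_object by blast
  then obtain u where u: "u \<in> Hom C Z N" using Z unfolding zero_object_def by blast
  note i = Ide_closed[OF Z] and n = Ide_closed[OF Hom_Ob(2)[OF u]]
  have "\<exists>!t. t \<in> Hom C W Z \<and> u \<cdot> t = v \<and> Ide C Z \<cdot> t = w"
    if "v \<in> Hom C W N" "w \<in> Hom C W Z" "Ide C N \<cdot> v = u \<cdot> w" for W v w
    using that Ide_left by metis
  then have "is_pullback C (Ide C N) u (Ide C Z) u"
    using Hom_D[OF u] Hom_D[OF i] Hom_D[OF n] Ide_left[OF u] Ide_right[OF u]
    unfolding is_pullback_def by auto
  then show ?thesis using deflation_pullback Ide_zero_deflation N by blast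
qed

text \<open>The injection \<^term>\<open>i\<close> of a biproduct is the pushout along \<open>0\<close> of the kernel of an identity.\<close>

lemma biproduct_inflation:
  assumes b: "biproduct C X Z P i j p q" shows "inflation E i"
proof -
  have h: "i \<in> Hom C X P" "j \<in> Hom C Z P" "p \<in> Hom C P X" "q \<in> Hom C P Z"
    and e: "p \<cdot> i = Ide C X" "q \<cdot> j = Ide C Z" "p \<cdot> j = Nul C Z X" "q \<cdot> i = Nul C X Z"
      "i \<cdot> p \<boxplus> j \<cdot> q = Ide C P"
    using b by (auto simp: biproduct_def)
  have ob: "X \<in> Ob C" "Z \<in> Ob C" "P \<in> Ob C" using h Hom_Ob by blast+
  obtain k where k: "(k, Ide C Z) \<in> E" using Ide_deflation[OF ob(2)] unfolding deflation_def by blast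
  define K where "K = Dom C k"
  have kz: "k \<in> Hom C K Z" "Ide C Z \<cdot> k = Nul C K Z"
    using kernel_cokernel[OF k] Hom_D[OF Ide_closed[OF ob(2)]] by (auto simp: is_kernel_def Hom_def K_def)
  then have k0: "k = Nul C K Z" using Ide_left by simp
  have K: "K \<in> Ob C" using kz Hom_Ob by blast
  note z = Nul_closed[OF K ob(1)]
  \<comment> \<open>Both maps out of \<open>K\<close> are zero, so every pair \<open>u\<close>,
    \<open>v\<close> is compatible and the pushout property reduces to the coproduct property of
    \<open>P\<close>.\<close>
  have univ: "\<exists>!t. t \<in> Hom C P W \<and> t \<cdot> j = u \<and> t \<cdot> i = v"
    if u: "u \<in> Hom C Z W" and v: "v \<in> Hom C X W" for W u v
  proof (rule ex1I[of _ "v \<cdot> p \<boxplus> u \<cdot> q"])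
    note vu = Cmp_closed[OF h(3) v] Cmp_closed[OF h(4) u]
    show "v \<cdot> p \<boxplus> u \<cdot> q \<in> Hom C P W \<and> (v \<cdot> p \<boxplus> u \<cdot> q) \<cdot> j = u \<and> (v \<cdot> p \<boxplus> u \<cdot> q) \<cdot> i = v"
      using Add_closed[OF vu] Cmp_Add_left[OF h(1) vu] Cmp_Add_left[OF h(2) vu]
        Cmp_assoc[OF h(1,3) v] Cmp_assoc[OF h(1,4) u] Cmp_assoc[OF h(2,3) v] Cmp_assoc[OF h(2,4) u]
        Cmp_Nul_right[OF v ob(2)] Cmp_Nul_right[OF u ob(1)] Add_Nul[OF u] Add_Nul[OF v]
        Ide_right[OF u] Ide_right[OF v] e by simp
    show "t = v \<cdot> p \<boxplus> u \<cdot> q" if t: "t \<in> Hom C P W \<and> t \<cdot> j = u \<and> t \<cdot> i = v" for t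
    proof -
      have t': "t \<in> Hom C P W" using t by blast
      show ?thesis
        using Cmp_Add_right[OF Cmp_closed[OF h(3,1)] Cmp_closed[OF h(4,2)] t'] e(5) Ide_right[OF t']
          Cmp_assoc[OF h(3,1) t'] Cmp_assoc[OF h(4,2) t'] t by simp
    qed
  qed
  have "is_pushout C k (Nul C K X) i j"
    using Hom_D[OF kz(1)] Hom_D[OF z] Hom_D[OF h(1)] Hom_D[OF h(2)] univ k0
      Cmp_Nul_right[OF h(1) K] Cmp_Nul_right[OF h(2) K] unfolding is_pushout_def by auto
  then show ?thesis using inflation_pushout k unfolding inflation_def by blast
qed

text \<open>Closure under isomorphisms, applied with two of the three isomorphisms equal to
  identities, permits exchanging one kernel or cokernel. For a biproduct, \<open>i\<close> is an
  inflation with some cokernel, which is exchanged for \<open>q\<close>.\<close>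

lemma preexact_structure: "preexact_structure C E"
proof (intro preexact_structure.intro additive_category_axioms preexact_structure_axioms.intro)
  fix f g f' assume fg: "(f, g) \<in> E" and k: "is_kernel C f' g"
  obtain a where a: "isomorphism C (Dom C f) (Dom C f') a" "f' \<cdot> a = f"
    using kernel_unique[OF k] kernel_cokernel[OF fg] by blast
  have h: "f \<in> Hom C (Dom C f) (Cod C f)" "f' \<in> Hom C (Dom C f') (Cod C f)"
    "g \<in> Hom C (Cod C f) (Cod C g)"
    using kernel_cokernel[OF fg] k by (auto simp: is_kernel_def Hom_def)
  show "(f', g) \<in> E"
    using iso_closed[OF fg a(1) Ide_isomorphism Ide_isomorphism h(2,3)] a(2)
      Hom_Ob[OF h(3)] Ide_left[OF h(1)] Ide_left[OF h(3)] Ide_right[OF h(3)] by simp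
next
  fix f g g' assume fg: "(f, g) \<in> E" and k: "is_cokernel C g' f"
  obtain c where c: "isomorphism C (Cod C g) (Cod C g') c" "c \<cdot> g = g'"
    using cokernel_unique[OF _ k] kernel_cokernel[OF fg] by blast
  have h: "f \<in> Hom C (Dom C f) (Cod C f)" "g' \<in> Hom C (Cod C f) (Cod C g')"
    using kernel_cokernel[OF fg] k by (auto simp: is_cokernel_def Hom_def)
  show "(f, g') \<in> E"
    using iso_closed[OF fg Ide_isomorphism Ide_isomorphism c(1) h] c(2)
      Hom_Ob[OF h(1)] Ide_left[OF h(1)] Ide_right[OF h(1)] Ide_right[OF h(2)] by simp
next
  fix X Y P i j p q assume b: "biproduct C X Y P i j p q"
  then obtain g where g: "(i, g) \<in> E" using biproduct_inflation unfolding inflation_def by blast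
  obtain c where c: "isomorphism C (Cod C g) (Cod C q) c" "c \<cdot> g = q"
    using cokernel_unique[OF _ biproduct_cokernel[OF b]] kernel_cokernel[OF g] by blast
  have h: "i \<in> Hom C (Dom C i) (Cod C i)" "q \<in> Hom C (Cod C i) (Cod C q)"
    using biproduct_cokernel[OF b] by (auto simp: is_cokernel_def Hom_def)
  show "(i, q) \<in> E"
    using iso_closed[OF g Ide_isomorphism Ide_isomorphism c(1) h] c(2)
      Hom_Ob[OF h(1)] Ide_left[OF h(1)] Ide_right[OF h(1)] Ide_right[OF h(2)] by simp
qed (use kernel_cokernel deflation_pullback_ex deflation_pullback inflation_pushout_ex
    inflation_pushout in blast)+

text \<open>Composition of deflations is left as the only axiom to be checked by hand. Closure under
  isomorphisms is shared between the two classes: the ambient \<open>E\<close> shows that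
  \<open>f'\<close> is a kernel of \<open>g'\<close>, and \<open>P\<close> shows that
  \<open>g'\<close> is a deflation.\<close>

lemma exact_substructure:
  assumes "preexact_structure C P" and sub: "P \<subseteq> E"
    and comp: "\<And>d e. \<lbrakk>deflation P d; deflation P e; Cod C d = Dom C e\<rbrakk> \<Longrightarrow> deflation P (e \<cdot> d)"
  shows "exact_structure C P"
proof -
  interpret P: preexact_structure C P by fact
  show ?thesis
  proof (intro exact_structure.intro additive_category_axioms exact_structure_axioms.intro)
    fix f g X a Y b Z c f' g'
    assume fg: "(f, g) \<in> P" and iso: "isomorphism C (Dom C f) X a" "isomorphism C (Cod C f) Y b"
      "isomorphism C (Cod C g) Z c" "f' \<in> Hom C X Y" "g' \<in> Hom C Y Z" "f' \<cdot> a = b \<cdot> f" "g' \<cdot> b = c \<cdot> g"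
    have "is_kernel C f' g'" using iso_closed[OF subsetD[OF sub fg] iso] kernel_cokernel by blast
    moreover have "Cod C f = Dom C g" using P.conflation[OF fg] by (simp add: is_kernel_def)
    then have "deflation P g'"
      using P.deflation_iso_closed[of g Y b Z c g'] fg iso unfolding deflation_def by auto
    ultimately show "(f', g') \<in> P" using P.deflation_conflation by blast
  qed (use P.conflation P.zero_object_Ide_deflation comp P.pullback_ex P.pullback_deflation
      P.pushout_ex P.pushout_inflation in blast)+
qed

section \<open>Exactness of the two generated classes\<close>

lemma proj_generated_exact:
  assumes M: "\<M> \<subseteq> Ob C" shows "exact_structure C (proj_generated C E \<M>)"
proof -
  interpret pre: preexact_structure C E by (rule preexact_structure)
  note mem = pre.proj_generated_iff[OF M]
  show ?thesis
  proof (rule exact_substructure[OF pre.proj_generated_preexact[OF M]])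
    show "proj_generated C E \<M> \<subseteq> E" by (auto simp: proj_generated_def)
    fix d e
    assume "deflation (proj_generated C E \<M>) d" "deflation (proj_generated C E \<M>) e"
      and de: "Cod C d = Dom C e"
    then obtain k m where k: "(k, d) \<in> proj_generated C E \<M>" and m: "(m, e) \<in> proj_generated C E \<M>"
      unfolding deflation_def by blast
    then have kE: "(k, d) \<in> E" and mE: "(m, e) \<in> E" by (simp_all add: proj_generated_def)
    then obtain p where p: "(p, e \<cdot> d) \<in> E"
      using deflation_comp[of d e] de unfolding deflation_def by blast
    have h: "d \<in> Hom C (Dom C d) (Dom C e)" "e \<in> Hom C (Dom C e) (Cod C e)"
      using kernel_cokernel[OF kE] kernel_cokernel[OF mE] de by (auto simp: is_kernel_def Hom_def)
    note ed = Hom_D[OF Cmp_closed[OF h]]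
    have "\<exists>v\<in>Hom C M (Dom C d). e \<cdot> d \<cdot> v = u" if u: "M \<in> \<M>" "u \<in> Hom C M (Cod C e)" for M u
    proof -
      obtain w where w: "w \<in> Hom C M (Dom C e)" "e \<cdot> w = u" using m u mem[of m e] by auto
      obtain v where v: "v \<in> Hom C M (Dom C d)" "d \<cdot> v = w" using k u w mem[of k d] de by auto
      show ?thesis using v w Cmp_assoc[OF v(1) h] by auto
    qed
    then show "deflation (proj_generated C E \<M>) (e \<cdot> d)"
      using mem[of p "e \<cdot> d"] p ed unfolding deflation_def by auto
  qed
qed

text \<open>Dualizing the projective case would prove that inflations compose, whereas Keller's
  axiom concerns deflations. The key is that the kernel of \<open>e \<cdot> d\<close> is itself an
  extension of the kernel of \<open>e\<close> by the kernel of \<open>d\<close>, so a morphism on it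
  can be extended in two stages.\<close>

lemma inj_generated_exact:
  assumes M: "\<M> \<subseteq> Ob C" shows "exact_structure C (inj_generated C E \<M>)"
proof -
  interpret pre: preexact_structure C E by (rule preexact_structure)
  note mem = pre.inj_generated_iff[OF M]
  show ?thesis
  proof (rule exact_substructure[OF pre.inj_generated_preexact[OF M]])
    show "inj_generated C E \<M> \<subseteq> E" by (auto simp: inj_generated_def)
    fix d e
    assume "deflation (inj_generated C E \<M>) d" "deflation (inj_generated C E \<M>) e"
      and de: "Cod C d = Dom C e"
    then obtain k m where k: "(k, d) \<in> inj_generated C E \<M>" and m: "(m, e) \<in> inj_generated C E \<M>"
      unfolding deflation_def by blast
    then have kE: "(k, d) \<in> E" and mE: "(m, e) \<in> E" by (simp_all add: inj_generated_def)
    then obtain p where p: "(p, e \<cdot> d) \<in> E"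
      using deflation_comp[of d e] de unfolding deflation_def by blast
    define X Y Z W K P where "X = Dom C k" "Y = Dom C d" "Z = Dom C e" "W = Cod C e"
      "K = Dom C m" "P = Dom C p"
    note defs = this
    have kd: "k \<in> Hom C X Y" "d \<in> Hom C Y Z" "d \<cdot> k = Nul C X Z" "is_kernel C k d"
      using kernel_cokernel[OF kE] de by (auto simp: is_kernel_def Hom_def defs)
    have me: "m \<in> Hom C K Z" "e \<in> Hom C Z W" "e \<cdot> m = Nul C K W" "is_kernel C m e"
      using kernel_cokernel[OF mE] by (auto simp: is_kernel_def Hom_def defs)
    have ed: "e \<cdot> d \<in> Hom C Y W" using kd me Cmp_closed by blast
    have pe: "p \<in> Hom C P Y" "e \<cdot> d \<cdot> p = Nul C P W" "is_kernel C p (e \<cdot> d)"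
      using kernel_cokernel[OF p] Hom_D[OF ed] by (auto simp: is_kernel_def Hom_def defs)
    have ob: "X \<in> Ob C" "Z \<in> Ob C" "P \<in> Ob C" "K \<in> Ob C" "W \<in> Ob C"
      using kd me pe Hom_Ob by blast+
    have dp: "d \<cdot> p \<in> Hom C P Z" using pe kd Cmp_closed by blast
    obtain q where q: "q \<in> Hom C P K" "m \<cdot> q = d \<cdot> p"
      using kernel_factor[OF me(4,1,2) dp] pe(2) Cmp_assoc[OF pe(1) kd(2) me(2)] by auto
    \<comment> \<open>The kernel of \<open>e \<circ> d\<close> is the preimage under \<open>d\<close> of the kernel of \<open>e\<close>.\<close>
    have "is_pullback C d m q p"
    proof -
      have "\<exists>!t. t \<in> Hom C V P \<and> p \<cdot> t = u \<and> q \<cdot> t = v"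
        if u: "u \<in> Hom C V Y" and v: "v \<in> Hom C V K" and uv: "d \<cdot> u = m \<cdot> v" for V u v
      proof -
        have "e \<cdot> d \<cdot> u = Nul C V W"
          using Cmp_assoc[OF u kd(2) me(2)] Cmp_assoc[OF v me(1,2)] uv me(3) Cmp_Nul_left[OF v ob(5)]
          by simp
        then obtain t where t: "t \<in> Hom C V P" "p \<cdot> t = u" using kernel_factor[OF pe(3,1) ed u] by blast
        have "m \<cdot> (q \<cdot> t) = m \<cdot> v"
          using Cmp_assoc[OF t(1) q(1) me(1)] Cmp_assoc[OF t(1) pe(1) kd(2)] q(2) t(2) uv by simp
        then have "q \<cdot> t = v" using kernel_mono[OF me(4,1) Cmp_closed[OF t(1) q(1)] v] by simp
        then show ?thesis using t kernel_mono[OF pe(3,1)] by blast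
      qed
      then show ?thesis
        using kd(2)[THEN Hom_D] me(1)[THEN Hom_D] q(1)[THEN Hom_D] pe(1)[THEN Hom_D] q(2)
        unfolding is_pullback_def by auto
    qed
    then obtain j where j: "j \<in> Hom C X P" "p \<cdot> j = k" "is_kernel C j q"
      using pullback_kernel[OF _ kd(4)] q(1)[THEN Hom_D] pe(1)[THEN Hom_D] kd(1)[THEN Hom_D] by metis
    have "deflation E q"
      using deflation_pullback \<open>is_pullback C d m q p\<close> kE unfolding deflation_def by blast
    then have jq: "is_cokernel C q j" using pre.deflation_conflation j(3) kernel_cokernel by blast
    have "\<exists>h\<in>Hom C Y M. h \<cdot> p = \<phi>" if \<phi>: "M \<in> \<M>" "\<phi> \<in> Hom C P M" for M \<phi>
    proof -
      \<comment> \<open>Extend \<open>\<phi>\<close> from the kernel of \<open>d\<close> to \<open>\<psi>\<close> on \<open>Y\<close>; the difference then factors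
        through \<open>q\<close> and extends from the kernel of \<open>e\<close>.\<close>
      obtain \<psi> where \<psi>: "\<psi> \<in> Hom C Y M" "\<psi> \<cdot> k = \<phi> \<cdot> j"
        using k \<phi> mem[of k d] Cmp_closed[OF j(1) \<phi>(2)] Hom_D[OF kd(1)] by auto
      have \<psi>p: "\<psi> \<cdot> p \<in> Hom C P M" using \<psi> pe Cmp_closed by blast
      obtain w where w: "w \<in> Hom C P M" "\<phi> = w \<boxplus> \<psi> \<cdot> p" using difference_ex[OF \<phi>(2) \<psi>p] by blast
      have "\<psi> \<cdot> p \<cdot> j = \<phi> \<cdot> j" using Cmp_assoc[OF j(1) pe(1) \<psi>(1)] j(2) \<psi>(2) by simp
      then have "w \<cdot> j \<boxplus> \<phi> \<cdot> j = \<phi> \<cdot> j" using Cmp_Add_left[OF j(1) w(1) \<psi>p] w(2) by simp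
      then have "w \<cdot> j = Nul C X M"
        using Add_cancel[OF Cmp_closed[OF j(1) w(1)] Cmp_closed[OF j(1) \<phi>(2)]] by simp
      then obtain \<chi> where \<chi>: "\<chi> \<in> Hom C K M" "\<chi> \<cdot> q = w" using cokernel_factor[OF jq j(1) q(1) w(1)] by blast
      then obtain \<omega> where \<omega>: "\<omega> \<in> Hom C Z M" "\<omega> \<cdot> m = \<chi>"
        using m \<phi>(1) mem[of m e] Hom_D[OF me(1)] by auto
      have \<omega>d: "\<omega> \<cdot> d \<in> Hom C Y M" using \<omega> kd Cmp_closed by blast
      have "\<omega> \<cdot> d \<cdot> p = w"
        using Cmp_assoc[OF pe(1) kd(2) \<omega>(1)] Cmp_assoc[OF q(1) me(1) \<omega>(1)] q(2) \<omega>(2) \<chi>(2) by simp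
      then have "(\<omega> \<cdot> d \<boxplus> \<psi>) \<cdot> p = \<phi>" using Cmp_Add_left[OF pe(1) \<omega>d \<psi>(1)] w(2) by simp
      then show ?thesis using Add_closed[OF \<omega>d \<psi>(1)] by blast
    qed
    then show "deflation (inj_generated C E \<M>) (e \<cdot> d)"
      using mem[of p "e \<cdot> d"] p Hom_D[OF pe(1)] unfolding deflation_def by auto
  qed
qed

end


section \<open>The Galois connections\<close>

lemma partial_order_exact_order: "partial_order (exact_order \<E>)"
  by unfold_locales (auto simp: exact_order_def)

text \<open>\<open>cot_ge\<close> compares first components only; antisymmetry holds because the
  second component of a cotorsion pair is the right orthogonal of the first.\<close>

lemma partial_order_cot_order: "partial_order (cot_order (cotorsion_pairs C D))"
  by unfold_locales (auto simp: cot_order_def cot_ge_def cotorsion_pairs_def)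

text \<open>Isotony of both maps is a consequence of the adjunction equivalence, so it is not among
  the premises.\<close>

lemma monotone_galois_connectionI:
  assumes "partial_order A" "partial_order B"
    and "\<And>a. a \<in> carrier A \<Longrightarrow> \<alpha> a \<in> carrier B" "\<And>b. b \<in> carrier B \<Longrightarrow> \<beta> b \<in> carrier A"
    and "\<And>a b. a \<in> carrier A \<Longrightarrow> b \<in> carrier B \<Longrightarrow> le B (\<alpha> a) b \<longleftrightarrow> le A a (\<beta> b)"
  shows "monotone_galois_connection A B \<alpha> \<beta>"
proof -
  interpret galois_connection "\<lparr>orderA = A, orderB = B, lower = \<alpha>, upper = \<beta>\<rparr>"
    using assms by (intro galois_connection.intro connection.intro galois_connection_axioms.intro) auto
  show ?thesis
    using lower_iso upper_iso galois_connection_axioms by (simp add: monotone_galois_connection_def)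
qed

context exact_structure
begin

lemma Psi_galois:
  "monotone_galois_connection (exact_order (DPEx C E)) (cot_order (cotorsion_pairs C E))
     (Psi C E) (Psi_tilde C E)"
proof (rule monotone_galois_connectionI[OF partial_order_exact_order partial_order_cot_order])
  interpret pre: preexact_structure C E by (rule preexact_structure)
  show "Psi C E F \<in> carrier (cot_order (cotorsion_pairs C E))"
    if "F \<in> carrier (exact_order (DPEx C E))" for F
    using that cotorsion_pair_generated
    by (auto simp: exact_order_def cot_order_def DPEx_def Psi_def pre.divisible_proj_generated)
  show "Psi_tilde C E T \<in> carrier (exact_order (DPEx C E))"
    if "T \<in> carrier (cot_order (cotorsion_pairs C E))" for T
    using that proj_generated_exact
    by (auto simp: exact_order_def cot_order_def DPEx_def Psi_tilde_def cotorsion_pairs_def)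
  fix F T
  assume "F \<in> carrier (exact_order (DPEx C E))" "T \<in> carrier (cot_order (cotorsion_pairs C E))"
  then obtain \<M> \<A> \<B> where M: "\<M> \<subseteq> Ob C" "F = proj_generated C E \<M>" and T: "T = (\<A>, \<B>)"
    and A: "\<A> \<subseteq> Ob C" "right_perp C E \<A> = \<B>" "left_perp C E \<B> = \<A>"
    by (auto simp: exact_order_def cot_order_def DPEx_def cotorsion_pairs_def)
  have "left_perp C E (right_perp C E \<M>) \<subseteq> \<A> \<longleftrightarrow> proj_generated C E \<A> \<subseteq> F"
  proof
    assume "left_perp C E (right_perp C E \<M>) \<subseteq> \<A>"
    then have "\<M> \<subseteq> \<A>" using perp_closure(1)[OF M(1)] by blast
    then show "proj_generated C E \<A> \<subseteq> F" unfolding M(2) proj_generated_def by blast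
  next
    assume "proj_generated C E \<A> \<subseteq> F"
    \<comment> \<open>A larger class has more divisible objects; applied to generated classes this
      turns an inclusion of conflations into an inclusion of right orthogonals.\<close>
    then have "divisible C E (proj_generated C E \<A>) \<subseteq> divisible C E F"
      unfolding divisible_def inflation_def by blast
    then have "\<B> \<subseteq> right_perp C E \<M>" using A M by (simp add: pre.divisible_proj_generated)
    then show "left_perp C E (right_perp C E \<M>) \<subseteq> \<A>" using left_perp_antimono A(3) by blast
  qed
  then show "le (cot_order (cotorsion_pairs C E)) (Psi C E F) T \<longleftrightarrow>
      le (exact_order (DPEx C E)) F (Psi_tilde C E T)"
    using M T by (simp add: exact_order_def cot_order_def cot_ge_def Psi_def Psi_tilde_def
        pre.divisible_proj_generated)
qed

text \<open>Cotorsion pairs are ordered by their first components. For \<open>Phi\<close> that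
  component is the class of flat objects, which grows with the exact structure, whereas for
  \<open>Psi\<close> it is the left orthogonal of a growing class; hence the reversed order on the
  target.\<close>

lemma Phi_galois:
  "antitone_galois_connection (exact_order (DIEx C E)) (cot_order (cotorsion_pairs C E))
     (Phi C E) (Phi_tilde C E)"
  unfolding antitone_galois_connection_def
proof (rule monotone_galois_connectionI[OF partial_order_exact_order
      partial_order.dual_order[OF partial_order_cot_order]])
  interpret pre: preexact_structure C E by (rule preexact_structure)
  show "Phi C E F \<in> carrier (inv_gorder (cot_order (cotorsion_pairs C E)))"
    if "F \<in> carrier (exact_order (DIEx C E))" for F
    using that cotorsion_pair_cogenerated
    by (auto simp: exact_order_def cot_order_def DIEx_def Phi_def pre.flat_inj_generated)
  show "Phi_tilde C E T \<in> carrier (exact_order (DIEx C E))"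
    if "T \<in> carrier (inv_gorder (cot_order (cotorsion_pairs C E)))" for T
    using that inj_generated_exact
    by (auto simp: exact_order_def cot_order_def DIEx_def Phi_tilde_def cotorsion_pairs_def)
  fix F T
  assume "F \<in> carrier (exact_order (DIEx C E))"
    "T \<in> carrier (inv_gorder (cot_order (cotorsion_pairs C E)))"
  then obtain \<M> \<A> \<B> where M: "\<M> \<subseteq> Ob C" "F = inj_generated C E \<M>" and T: "T = (\<A>, \<B>)"
    and B: "\<B> \<subseteq> Ob C" "right_perp C E \<A> = \<B>" "left_perp C E \<B> = \<A>"
    by (auto simp: exact_order_def cot_order_def DIEx_def cotorsion_pairs_def)
  have "\<A> \<subseteq> left_perp C E \<M> \<longleftrightarrow> inj_generated C E \<B> \<subseteq> F"
  proof
    assume "\<A> \<subseteq> left_perp C E \<M>"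
    \<comment> \<open>\<open>\<M>\<close> lies in its double orthogonal, and the hypothesis places
      that inside the right orthogonal of \<open>\<A>\<close>, which is \<open>\<B>\<close>.\<close>
    then have "\<M> \<subseteq> \<B>" using perp_closure(2)[OF M(1)] right_perp_antimono B(2) by blast
    then show "inj_generated C E \<B> \<subseteq> F" unfolding M(2) inj_generated_def by blast
  next
    assume "inj_generated C E \<B> \<subseteq> F"
    then have "flat C E (inj_generated C E \<B>) \<subseteq> flat C E F"
      unfolding flat_def deflation_def by blast
    then show "\<A> \<subseteq> left_perp C E \<M>" using B M by (simp add: pre.flat_inj_generated)
  qed
  then show "le (inv_gorder (cot_order (cotorsion_pairs C E))) (Phi C E F) T \<longleftrightarrow>
      le (exact_order (DIEx C E)) F (Phi_tilde C E T)"
    using M T by (simp add: exact_order_def cot_order_def cot_ge_def Phi_def Phi_tilde_def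
        pre.flat_inj_generated)
qed

end

theorem theorem3p7:
  fixes C :: "('o, 'm) precat" and D :: "('m \<times> 'm) set"
  assumes "additive_category C" and "exact_structure C D"
  shows "monotone_galois_connection
           (exact_order (DPEx C D)) (cot_order (cotorsion_pairs C D)) (Psi C D) (Psi_tilde C D) \<and>
         antitone_galois_connection
           (exact_order (DIEx C D)) (cot_order (cotorsion_pairs C D)) (Phi C D) (Phi_tilde C D)"
  using exact_structure.Psi_galois[OF assms(2)] exact_structure.Phi_galois[OF assms(2)] ..

end
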